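(* Let $A\in\mathscr{R}$ be a fixed set. In the risk model described in the context, suppose that the claim vectors $\{\mathbf{X}^{(i)}, i\in\mathbb{N}\}$ are identically distributed with common distribution $F$ supported on the nonnegative quadrant; that $\{\mathbf{X}^{(i)}, i\in\mathbb{N}\}$, $\{N(t), t\ge 0\}$ and $\{\xi(t), t\ge 0\}$ are mutually independent; that for any $T\in\varLambda\setminus\{\infty\}$ there exists a positive constant $K_T$ such that $\mathbf{P}\left[\inf_{0\le t\le T}\xi(t)\ge -K_T\right]=1$; that $\{\mathbf{X}^{(i)}, i\in\mathbb{N}\}$ are quasi-asymptotically independent on $A$ ($QAI_A$); and that $F\in\mathcal{C}_A$. Then for any fixed $T\in\varLambda\setminus\{\infty\}$, $$\lim_{x\to\infty}\frac{\mathbf{P}\left[\mathbf{D}(T)\in xA\right]}{\int_0^T \mathbf{P}\left[\mathbf{X}\,e^{-\xi(s)}\in xA\right]\lambda(ds)}=1 .$$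
   Context: Risk model. Fix $d\in\mathbb{N}$. The claim vectors $\mathbf{X}^{(i)}=(X^{(i)}_1,\dots,X^{(i)}_d)^\top$, $i\in\mathbb{N}$, are identically distributed copies of a random vector $\mathbf{X}$ with distribution $F$ supported on $[0,\infty)^d$; a claim vector may have zero components but is not the zero vector. They are not assumed independent of each other, and the components of each vector may be arbitrarily dependent. Claims arrive at random times $\{\tau_i, i\in\mathbb{N}\}$ forming a renewal counting process $N(t)=\sup\{i\in\mathbb{N}:\tau_i\le t\}$, $t\ge 0$ (with $\sup\emptyset=0$), i.e. $\tau_i$ are the partial sums of i.i.d. nonnegative inter-arrival times (not a.s. zero). Its renewal function $\lambda(t)=\mathbf{E}[N(t)]=\sum_{i\ge1}\mathbf{P}[\tau_i\le t]$ is finite for finite $t$, and $\lambda(ds)=\sum_{i\ge 1}\mathbf{P}[\tau_i\in ds]$ is the renewal measure. Put $\varLambda=\{t\ge 0: 0<\lambda(t)\le\infty\}$ (allowing $t=\infty$). $\{\xi(t),t\ge0\}$ is a real-valued càdlàg stochastic process with $\xi(0)=0$. The discounted aggregate claim vector is $\mathbf{D}(T)=\sum_{i=1}^{N(T)}\mathbf{X}^{(i)}e^{-\xi(\tau_i)}$. Sets. A set $B\subset\mathbb{R}^d$ is increasing if $\mathbf{x}+\mathbf{y}\in B$ for all $\mathbf{x}\in B$ and $\mathbf{y}\in[0,\infty)^d$. $\mathscr{R}$ is the family of all $A\subset\mathbb{R}^d$ that are open, increasing, with convex complement $A^c$, and with $\mathbf{0}\notin\overline{A}$. Reduction to one dimension.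 For a random vector $\mathbf{Z}$ supported on $[0,\infty)^d$ with distribution $V$ and $A\in\mathscr{R}$, put $Z_A=\sup\{u:\mathbf{Z}\in uA\}$ (with $\sup\emptyset=0$); its distribution $V_A$ satisfies $\overline{V_A}(x)=\mathbf{P}[Z_A>x]=\mathbf{P}[\mathbf{Z}\in xA]$ for $x>0$. Here $\overline{G}=1-G$ denotes the tail of a distribution $G$. Class $\mathcal{C}_A$. A distribution $G$ on $[0,\infty)$ with $\overline G(x)>0$ for all $x\ge0$ is consistently varying, $G\in\mathcal{C}$, if $\lim_{b\uparrow1}\limsup_{x\to\infty}\overline{G}(bx)/\overline{G}(x)=1$. $V\in\mathcal{C}_A$ means $V_A\in\mathcal{C}$. Dependence. Nonnegative random variables $\{Z_i,i\ge1\}$ with distributions $V_1,V_2,\dots$ are quasi-asymptotically independent (QAI) if $\lim_{x\to\infty}\mathbf{P}[Z_i>x,\,Z_j>x]/(\overline{V_i}(x)+\overline{V_j}(x))=0$ for all $i\ne j$. Nonnegative random vectors $\{\mathbf{Z}^{(i)},i\in\mathbb{N}\}$ are $QAI_A$ if the random variables $Z_A^{(i)}=\sup\{u:\mathbf{Z}^{(i)}\in uA\}$, $i\in\mathbb{N}$, are QAI. *)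

theory Defs
  imports "HOL-Probability.Probability"
begin

section \<open>Sets and the reduction to one dimension\<close>

definition increasing_set :: "(real ^ 'n) set \<Rightarrow> bool" where
  "increasing_set B \<longleftrightarrow> (\<forall>x\<in>B. \<forall>y. (\<forall>k. 0 \<le> y $ k) \<longrightarrow> x + y \<in> B)"

definition scaled_set :: "real \<Rightarrow> (real ^ 'n) set \<Rightarrow> (real ^ 'n) set" where
  "scaled_set u A = (\<lambda>a. u *\<^sub>R a) ` A"

definition family_R :: "(real ^ 'n) set set" where
  "family_R = {A. open A \<and> increasing_set A \<and> convex (- A) \<and> 0 \<notin> closure A}"

text \<open>The empty supremum is set to 0 explicitly, because \<open>Sup {}\<close> is unspecified on the reals.
  For \<open>A\<close> in \<open>family_R\<close> the set below is always bounded above, since \<open>0\<close> is not in the closure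
  of \<open>A\<close>.\<close>

definition scalarize :: "(real ^ 'n) set \<Rightarrow> real ^ 'n \<Rightarrow> real" where
  "scalarize A z =
     (if {u. z \<in> scaled_set u A} = {} then 0 else Sup {u. z \<in> scaled_set u A})"

section \<open>Heavy tails and dependence\<close>

definition tail :: "real measure \<Rightarrow> real \<Rightarrow> real" where
  "tail G x = 1 - cdf G x"

definition consistently_varying :: "real measure \<Rightarrow> bool" where
  "consistently_varying G \<longleftrightarrow>
     prob_space G \<and> sets G = sets borel \<and> (AE x in G. 0 \<le> x) \<and>
     (\<forall>x\<ge>0. tail G x > 0) \<and>
     ((\<lambda>b. Limsup at_top (\<lambda>x. ereal (tail G (b * x) / tail G x))) \<longlongrightarrow> 1) (at_left 1)"

definition consistently_varying_on :: "(real ^ 'n) set \<Rightarrow> (real ^ 'n) measure \<Rightarrow> bool" where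
  "consistently_varying_on A V \<longleftrightarrow> consistently_varying (distr V borel (scalarize A))"

definition QAI :: "'a measure \<Rightarrow> 'i set \<Rightarrow> ('i \<Rightarrow> 'a \<Rightarrow> real) \<Rightarrow> bool" where
  "QAI M I Z \<longleftrightarrow>
     (\<forall>i\<in>I. \<forall>j\<in>I. i \<noteq> j \<longrightarrow>
        ((\<lambda>x. \<P>(\<omega> in M. Z i \<omega> > x \<and> Z j \<omega> > x) /
               (tail (distr M borel (Z i)) x + tail (distr M borel (Z j)) x)) \<longlongrightarrow> 0) at_top)"

definition QAI_on ::
  "(real ^ 'n) set \<Rightarrow> 'a measure \<Rightarrow> 'i set \<Rightarrow> ('i \<Rightarrow> 'a \<Rightarrow> real ^ 'n) \<Rightarrow> bool" where
  "QAI_on A M I Z \<longleftrightarrow> QAI M I (\<lambda>i \<omega>. scalarize A (Z i \<omega>))"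

definition process_sigma ::
  "'a measure \<Rightarrow> 'b measure \<Rightarrow> 'i set \<Rightarrow> ('i \<Rightarrow> 'a \<Rightarrow> 'b) \<Rightarrow> 'a set set" where
  "process_sigma M S I Y =
     sigma_sets (space M) (\<Union>i\<in>I. {Y i -` B \<inter> space M | B. B \<in> sets S})"

definition cadlag :: "(real \<Rightarrow> real) \<Rightarrow> bool" where
  "cadlag f \<longleftrightarrow>
     (\<forall>t\<ge>0. (f \<longlongrightarrow> f t) (at_right t)) \<and> (\<forall>t>0. \<exists>l. (f \<longlongrightarrow> l) (at_left t))"

section \<open>The renewal risk model\<close>

text \<open>Claims are numbered from 1; \<open>\<theta> k\<close> is the inter-arrival time before claim \<open>k\<close>, and values
  of \<open>X\<close> and \<open>\<theta>\<close> at index 0 are never used.\<close>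

definition arrival_time :: "(nat \<Rightarrow> 'a \<Rightarrow> real) \<Rightarrow> nat \<Rightarrow> 'a \<Rightarrow> real" where
  "arrival_time \<theta> i \<omega> = (\<Sum>k=1..i. \<theta> k \<omega>)"

text \<open>The counting process takes values in \<^typ>\<open>enat\<close>, where the empty supremum is 0.
  It is infinite at most on a null set.\<close>

definition counting :: "(nat \<Rightarrow> 'a \<Rightarrow> real) \<Rightarrow> real \<Rightarrow> 'a \<Rightarrow> enat" where
  "counting \<theta> t \<omega> = (SUP i\<in>{i. 1 \<le> i \<and> arrival_time \<theta> i \<omega> \<le> t}. enat i)"

definition renewal_function :: "'a measure \<Rightarrow> (nat \<Rightarrow> 'a \<Rightarrow> real) \<Rightarrow> real \<Rightarrow> ennreal" where
  "renewal_function M \<theta> t = (\<integral>\<^sup>+\<omega>. ennreal_of_enat (counting \<theta> t \<omega>) \<partial>M)"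

definition renewal_measure :: "'a measure \<Rightarrow> (nat \<Rightarrow> 'a \<Rightarrow> real) \<Rightarrow> real measure" where
  "renewal_measure M \<theta> = measure_of UNIV (sets borel)
     (\<lambda>B. \<Sum>i. emeasure M {\<omega>\<in>space M. arrival_time \<theta> (Suc i) \<omega> \<in> B})"

text \<open>The finite elements of the set of \<open>t\<close> with positive renewal function.\<close>

definition finite_horizons :: "'a measure \<Rightarrow> (nat \<Rightarrow> 'a \<Rightarrow> real) \<Rightarrow> real set" where
  "finite_horizons M \<theta> = {t. 0 \<le> t \<and> 0 < renewal_function M \<theta> t}"

definition discounted_claims ::
  "(nat \<Rightarrow> 'a \<Rightarrow> real ^ 'n) \<Rightarrow> (nat \<Rightarrow> 'a \<Rightarrow> real) \<Rightarrow> (real \<Rightarrow> 'a \<Rightarrow> real) \<Rightarrow> real \<Rightarrow> 'a \<Rightarrow> real ^ 'n"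
where
  "discounted_claims X \<theta> \<xi> T \<omega> =
     (\<Sum>i | 1 \<le> i \<and> enat i \<le> counting \<theta> T \<omega>.
        exp (- \<xi> (arrival_time \<theta> i \<omega>) \<omega>) *\<^sub>R X i \<omega>)"

text \<open>Non-negativity of the inter-arrival times and path regularity of \<open>\<xi>\<close> hold for every \<open>\<omega>\<close>,
  so that \<open>\<xi> (arrival_time \<theta> i \<omega>) \<omega>\<close> is a random variable without completing \<open>M\<close>.\<close>

locale renewal_risk_model = prob_space M
  for M :: "'a measure" +
  fixes X :: "nat \<Rightarrow> 'a \<Rightarrow> real ^ 'n"
    and F :: "(real ^ 'n) measure"
    and \<theta> :: "nat \<Rightarrow> 'a \<Rightarrow> real"
    and \<xi> :: "real \<Rightarrow> 'a \<Rightarrow> real"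
  assumes X_measurable: "\<And>i. 1 \<le> i \<Longrightarrow> X i \<in> borel_measurable M"
    and X_distribution: "\<And>i. 1 \<le> i \<Longrightarrow> distr M borel (X i) = F"
    and F_nonneg: "AE x in F. \<forall>k. 0 \<le> x $ k"
    and F_nonzero: "AE x in F. x \<noteq> 0"
    and interarrival_indep: "indep_vars (\<lambda>_. borel) \<theta> {1..}"
    and interarrival_identical: "\<And>k. 1 \<le> k \<Longrightarrow> distr M borel (\<theta> k) = distr M borel (\<theta> 1)"
    and interarrival_nonneg: "\<And>k \<omega>. 1 \<le> k \<Longrightarrow> \<omega> \<in> space M \<Longrightarrow> 0 \<le> \<theta> k \<omega>"
    and interarrival_nonzero: "\<not> (AE \<omega> in M. \<theta> 1 \<omega> = 0)"
    and xi_measurable: "\<And>t. 0 \<le> t \<Longrightarrow> \<xi> t \<in> borel_measurable M"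
    and xi_cadlag: "\<And>\<omega>. \<omega> \<in> space M \<Longrightarrow> cadlag (\<lambda>t. \<xi> t \<omega>)"
    and xi_zero: "\<And>\<omega>. \<omega> \<in> space M \<Longrightarrow> \<xi> 0 \<omega> = 0"
begin

lemma arrival_time_measurable: "arrival_time \<theta> i \<in> borel_measurable M"
proof -
  have "\<theta> k \<in> borel_measurable M" if "k \<in> {1..i}" for k
    using interarrival_indep that by (auto simp: indep_vars_def)
  then show ?thesis
    unfolding arrival_time_def[abs_def] by (intro borel_measurable_sum) auto
qed

lemma emeasure_renewal_measure:
  assumes "B \<in> sets borel"
  shows "emeasure (renewal_measure M \<theta>) B =
    (\<Sum>i. emeasure M {\<omega>\<in>space M. arrival_time \<theta> (Suc i) \<omega> \<in> B})"
proof -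
  define \<mu> where "\<mu> = (\<lambda>i B. emeasure M {\<omega>\<in>space M. arrival_time \<theta> (Suc i) \<omega> \<in> B})"
  have \<mu>_distr: "\<mu> i B = emeasure (distr M borel (arrival_time \<theta> (Suc i))) B"
    if "B \<in> sets borel" for i B
    using that arrival_time_measurable[of "Suc i"]
    by (auto simp: \<mu>_def emeasure_distr intro!: arg_cong[where f="emeasure M"])
  have "emeasure (renewal_measure M \<theta>) B = (\<Sum>i. \<mu> i B)"
  proof (rule emeasure_measure_of)
    show "renewal_measure M \<theta> = measure_of UNIV (sets borel) (\<lambda>B. \<Sum>i. \<mu> i B)"
      by (simp add: renewal_measure_def \<mu>_def)
    show "sets borel \<subseteq> Pow (UNIV :: real set)" by simp
    show "B \<in> sets (renewal_measure M \<theta>)"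
      using assms sets.sigma_sets_eq[of "borel :: real measure"]
      by (simp add: renewal_measure_def sets_measure_of)
    show "positive (sets (renewal_measure M \<theta>)) (\<lambda>B. \<Sum>i. \<mu> i B)"
      by (simp add: positive_def \<mu>_def)
    have *: "sets (renewal_measure M \<theta>) = sets borel"
      using sets.sigma_sets_eq[of "borel :: real measure"]
      by (simp add: renewal_measure_def sets_measure_of)
    show "countably_additive (sets (renewal_measure M \<theta>)) (\<lambda>B. \<Sum>i. \<mu> i B)"
      unfolding *
    proof (rule countably_additiveI)
      fix S :: "nat \<Rightarrow> real set"
      assume S: "range S \<subseteq> sets borel" "disjoint_family S" "\<Union> (range S) \<in> sets borel"
      have "(\<Sum>j. \<Sum>i. \<mu> i (S j)) = (\<Sum>i. \<Sum>j. \<mu> i (S j))"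
        using nn_integral_suminf[of "\<lambda>i j. \<mu> i (S j)" "count_space UNIV"]
        by (simp add: nn_integral_count_space_nat)
      also have "\<dots> = (\<Sum>i. \<mu> i (\<Union> (range S)))"
      proof (rule suminf_cong)
        fix i
        have "(\<Sum>j. \<mu> i (S j)) =
            (\<Sum>j. emeasure (distr M borel (arrival_time \<theta> (Suc i))) (S j))"
          using S by (intro suminf_cong \<mu>_distr) auto
        also have "\<dots> = \<mu> i (\<Union> (range S))"
          using S by (subst suminf_emeasure) (auto simp: \<mu>_distr)
        finally show "(\<Sum>j. \<mu> i (S j)) = \<mu> i (\<Union> (range S))" .
      qed
      finally show "(\<Sum>j. \<Sum>i. \<mu> i (S j)) = (\<Sum>i. \<mu> i (\<Union> (range S)))" .
    qed
  qed
  then show ?thesis by (simp add: \<mu>_def)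
qed

end

end

theory Submission
  imports Defs "HOL-Real_Asymp.Real_Asymp"
begin

text \<open>Since the complement of \<open>A\<close> is convex and \<open>A\<close> is increasing, the map \<open>scalarize A\<close> is
  subadditive, positively homogeneous and monotone. With \<open>Z\<^sub>i\<close> the scalarized claims,
  \<open>c\<^sub>i = exp (- \<xi>(\<tau>\<^sub>i))\<close> on \<open>\<tau>\<^sub>i \<le> T\<close> (zero elsewhere) and \<open>Y\<^sub>i = c\<^sub>i Z\<^sub>i\<close>, the event \<open>D(T) \<in> xA\<close> therefore lies
  between \<open>max Y\<^sub>i > x\<close> and \<open>\<Sum> Y\<^sub>i > x\<close>, while the integral in the denominator is \<open>\<Sum>i. P(Y\<^sub>i > x)\<close>.
  For the first \<open>m\<close> claims, quasi-asymptotic independence makes two large \<open>Y\<^sub>i\<close> negligible, and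
  consistent variation allows the threshold \<open>x\<close> to be lowered slightly; the lower bound is
  Bonferroni's inequality. No uniformity over pairs of claims is available, so the event of more
  than \<open>m\<close> claims is handled by a union bound: given \<open>n\<close> claims one of them exceeds \<open>x / n\<close>, which
  costs a power of \<open>n\<close>, and \<open>P(\<tau>\<^sub>n \<le> T)\<close> decays geometrically.\<close>

subsection \<open>The scalarization\<close>

text \<open>Every error is first measured against \<open>tail G x\<close>, the tail of one
  scalarized claim, and only at the end against the denominator. The two are comparable: a
  Potter-type bound undoes any change of scale, so bounded weights make \<open>Y_tail i x\<close> at
  most a constant times \<open>prob (E i) * tail G x\<close>, and the first claim, which arrives by
  \<open>T\<close> with positive probability, gives a bound in the other direction. All claims share
  one distribution, so the constants do not depend on \<open>i\<close>. The weights of different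
  claims are strongly dependent, through the arrival times and the common path of \<xi>. The
  probabilistic core therefore relies only on independence of \<open>c i\<close> from
  \<open>Z i\<close> and of each event \<open>E n\<close> from each \<open>Z i\<close>, and applies
  the limit of quasi-asymptotic independence to the finitely many pairs below a fixed
  \<open>m\<close>. The denominator evaluates \<xi> at deterministic times, whereas the claims are
  discounted at random ones. Independence of arrivals and discounting, together with joint
  measurability of \<xi> in time and \<omega>, bridges this difference.\<close>

lemma scaled_set_iff: "x > 0 \<Longrightarrow> z \<in> scaled_set x A \<longleftrightarrow> (1/x) *\<^sub>R z \<in> A"
  unfolding scaled_set_def image_iff
  by (force intro: bexI[of _ "(1/x) *\<^sub>R z"])

lemma open_scaled_set: "open A \<Longrightarrow> x > 0 \<Longrightarrow> open (scaled_set x A)"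
  unfolding scaled_set_def by (rule open_scaling) auto

context
  fixes A :: "(real ^ 'n) set"
  assumes A: "A \<in> family_R"
begin

lemma zero_notin: "0 \<notin> A"
  using A closure_subset[of A] by (auto simp: family_R_def)

text \<open>\<open>z\<close> lies on the segment from 0 to \<open>r *\<^sub>R z\<close>. If the far
  end were outside \<open>A\<close>, both ends would be in the convex complement, and so would
  \<open>z\<close>.\<close>

lemma family_R_scale_up:
  assumes "z \<in> A" "1 \<le> r"
  shows "r *\<^sub>R z \<in> A"
proof (rule ccontr)
  assume "r *\<^sub>R z \<notin> A"
  moreover have "convex (- A)" using A by (simp add: family_R_def)
  ultimately have "(1 - 1/r) *\<^sub>R 0 + (1/r) *\<^sub>R (r *\<^sub>R z) \<in> - A"
    using assms(2) zero_notin by (intro convexD) auto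
  with assms show False by simp
qed

text \<open>\<open>A\<close> keeps a distance \<open>e\<close> from the origin, so a positive
  \<open>u\<close> in the set satisfies \<open>u * e \<le> norm z\<close>; other \<open>u\<close>
  are trivially bounded.\<close>

lemma scalarize_bdd_above: "bdd_above {u. z \<in> scaled_set u A}"
proof -
  have "0 \<notin> closure A" using A by (simp add: family_R_def)
  then obtain e where e: "e > 0" "\<And>y. y \<in> A \<Longrightarrow> e \<le> norm y"
    unfolding closure_approachable by (auto simp: not_less)
  have "u \<le> norm z / e" if "z \<in> scaled_set u A" for u
  proof (cases "u > 0")
    case True
    then have "e \<le> norm ((1/u) *\<^sub>R z)" using that scaled_set_iff e(2) by blast
    with True e(1) show ?thesis by (simp add: field_simps)
  next
    case False
    moreover have "0 \<le> norm z / e" using e(1) by simp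
    ultimately show ?thesis by linarith
  qed
  then show ?thesis by (auto intro!: bdd_aboveI)
qed

text \<open>The sets \<open>scaled_set u A\<close> shrink as \<open>u > 0\<close> grows, which gives
  one direction. The strict inequality in the other comes from openness of \<open>A\<close>:
  membership at \<open>x\<close> persists at a slightly larger scale, so \<open>x\<close> lies
  strictly below the supremum.\<close>

lemma scalarize_gt_iff:
  assumes "x > 0"
  shows "x < scalarize A z \<longleftrightarrow> z \<in> scaled_set x A"
proof
  assume "x < scalarize A z"
  then obtain u where u: "z \<in> scaled_set u A" "x < u"
    using assms scalarize_bdd_above[of z]
    by (auto simp: scalarize_def less_cSup_iff split: if_splits)
  then have "(u/x) *\<^sub>R ((1/u) *\<^sub>R z) \<in> A"
    using assms by (intro family_R_scale_up[of "(1/u) *\<^sub>R z"]) (auto simp: scaled_set_iff)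
  then show "z \<in> scaled_set x A" using assms u by (simp add: scaled_set_iff)
next
  assume z: "z \<in> scaled_set x A"
  have "open ((\<lambda>u. (1/u) *\<^sub>R z) -` A \<inter> {0<..})"
    using A unfolding family_R_def
    by (subst Int_commute, intro continuous_open_preimage continuous_intros) auto
  moreover have "x \<in> (\<lambda>u. (1/u) *\<^sub>R z) -` A \<inter> {0<..}"
    using z assms by (auto simp: scaled_set_iff)
  ultimately obtain e where e: "e > 0" "ball x e \<subseteq> (\<lambda>u. (1/u) *\<^sub>R z) -` A \<inter> {0<..}"
    by (meson openE)
  have "x + e/2 \<in> ball x e" using e(1) by (auto simp: dist_real_def)
  then have "z \<in> scaled_set (x + e/2) A"
    using e assms by (auto simp: scaled_set_iff)
  then have "x + e/2 \<le> scalarize A z"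
    using scalarize_bdd_above[of z] by (auto simp: scalarize_def intro!: cSup_upper)
  with e(1) show "x < scalarize A z" by simp
qed

text \<open>For a general vector \<open>z\<close> the set may contain negative scales. From
  \<open>z = u *\<^sub>R a\<close> with \<open>u < 0\<close>, scaling \<open>a\<close> up moves the
  scale towards 0; the \<open>v\<close> chosen below is still negative, satisfies
  \<open>u / v \<ge> 1\<close> and exceeds the supposed negative supremum.\<close>

lemma scalarize_nonneg: "0 \<le> scalarize A z"
proof (rule ccontr)
  assume "\<not> 0 \<le> scalarize A z"
  then have ne: "{u. z \<in> scaled_set u A} \<noteq> {}" and S: "scalarize A z = Sup {u. z \<in> scaled_set u A}"
    and neg: "scalarize A z < 0"
    by (auto simp: scalarize_def split: if_splits)
  then obtain u where u: "z \<in> scaled_set u A" by auto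
  have up: "u' \<le> scalarize A z" if "z \<in> scaled_set u' A" for u'
    using scalarize_bdd_above[of z] that by (auto simp: S intro!: cSup_upper)
  have "u < 0" using up[OF u] neg by simp
  obtain a where a: "a \<in> A" "z = u *\<^sub>R a" using u by (auto simp: scaled_set_def)
  define v where "v = max (u/2) (scalarize A z / 2)"
  have v: "v < 0" "u/v \<ge> 1" "v > scalarize A z"
    using \<open>u < 0\<close> neg up[OF u] by (auto simp: v_def max_def field_simps)
  have "(u/v) *\<^sub>R a \<in> A" using a v by (intro family_R_scale_up)
  moreover have "z = v *\<^sub>R ((u/v) *\<^sub>R a)" using v a by simp
  ultimately have "z \<in> scaled_set v A" unfolding scaled_set_def by blast
  from up[OF this] v show False by simp
qed

lemma scalarize_measurable: "scalarize A \<in> borel_measurable borel"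
proof (rule borel_measurableI_greater)
  fix y :: real
  consider "y < 0" | "y \<ge> 0" using not_le by blast
  then show "{x \<in> space borel. y < scalarize A x} \<in> sets borel"
  proof cases
    case 1
    then have "{x \<in> space borel. y < scalarize A x} = UNIV"
      using scalarize_nonneg by (auto intro: less_le_trans)
    then show ?thesis by simp
  next
    case 2
    \<comment> \<open>Membership in a scaled set describes positive thresholds only, so
      \<open>y = 0\<close> has to be approached from above.\<close>
    have "y < scalarize A x \<longleftrightarrow> (\<exists>n::nat. x \<in> scaled_set (y + 1 / Suc n) A)" for x
    proof
      assume "y < scalarize A x"
      then obtain n where "inverse (real (Suc n)) < scalarize A x - y"
        using reals_Archimedean[of "scalarize A x - y"] by auto
      then have "y + 1 / Suc n < scalarize A x" by (simp add: field_simps)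
      then show "\<exists>n::nat. x \<in> scaled_set (y + 1 / Suc n) A"
        using 2 by (intro exI[of _ n], subst scalarize_gt_iff[symmetric]) (auto intro!: add_nonneg_pos)
    next
      assume "\<exists>n::nat. x \<in> scaled_set (y + 1 / Suc n) A"
      then obtain n :: nat where "x \<in> scaled_set (y + 1 / Suc n) A" ..
      moreover have p: "1 / real (Suc n) > 0" by simp
      then have "y + 1 / Suc n > 0" using 2 by linarith
      ultimately have "y + 1 / Suc n < scalarize A x" by (simp only: scalarize_gt_iff)
      with p show "y < scalarize A x" by linarith
    qed
    then have "{x \<in> space borel. y < scalarize A x} = (\<Union>n::nat. scaled_set (y + 1 / Suc n) A)"
      by auto
    also have "\<dots> \<in> sets borel"
    proof (intro sets.countable_UN image_subsetI borel_open open_scaled_set)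
      show "open A" using A by (simp add: family_R_def)
      show "0 < y + 1 / real (Suc n)" for n using 2 by (intro add_nonneg_pos) auto
    qed
    finally show ?thesis .
  qed
qed

lemma scalarize_zero: "scalarize A 0 = 0"
proof (rule ccontr)
  assume "scalarize A 0 \<noteq> 0"
  then have "0 < scalarize A 0" using scalarize_nonneg[of 0] by linarith
  then obtain x where "0 < x" "x < scalarize A 0" using dense by meson
  then show False using scalarize_gt_iff[of x 0] zero_notin by (auto simp: scaled_set_iff)
qed

lemma scalarize_scaleR:
  assumes "0 < r"
  shows "scalarize A (r *\<^sub>R z) = r * scalarize A z"
proof -
  have iff: "x < scalarize A (r *\<^sub>R z) \<longleftrightarrow> x < r * scalarize A z" if "x > 0" for x
  proof -
    have "x < scalarize A (r *\<^sub>R z) \<longleftrightarrow> (r / x) *\<^sub>R z \<in> A"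
      using that by (simp add: scalarize_gt_iff scaled_set_iff)
    also have "\<dots> \<longleftrightarrow> x / r < scalarize A z"
      using assms that by (simp add: scalarize_gt_iff scaled_set_iff)
    finally show ?thesis using assms by (simp add: field_simps)
  qed
  have nn: "0 \<le> scalarize A (r *\<^sub>R z)" "0 \<le> r * scalarize A z"
    using assms scalarize_nonneg by auto
  show ?thesis
  proof (rule antisym; rule ccontr)
    assume "\<not> scalarize A (r *\<^sub>R z) \<le> r * scalarize A z"
    then obtain x where "r * scalarize A z < x" "x < scalarize A (r *\<^sub>R z)"
      by (meson dense not_le)
    then show False using iff[of x] nn by simp
  next
    assume "\<not> r * scalarize A z \<le> scalarize A (r *\<^sub>R z)"
    then obtain x where "scalarize A (r *\<^sub>R z) < x" "x < r * scalarize A z"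
      by (meson dense not_le)
    then show False using iff[of x] nn by simp
  qed
qed

text \<open>For \<open>a\<close>, \<open>b\<close> above the two scalarizations,
  \<open>v / a\<close> and \<open>w / b\<close> lie in the convex complement of \<open>A\<close>.
  Their combination with weights \<open>a / (a + b)\<close> and \<open>b / (a + b)\<close> is
  \<open>(v + w) / (a + b)\<close>, which is therefore outside \<open>A\<close> as well.\<close>

lemma scalarize_add: "scalarize A (v + w) \<le> scalarize A v + scalarize A w"
proof (rule ccontr)
  assume *: "\<not> ?thesis"
  \<comment> \<open>A quarter of the gap leaves \<open>a + b\<close> strictly below the left-hand
    side and keeps \<open>a\<close> and \<open>b\<close> positive even if both scalarizations
    vanish.\<close>
  define e where "e = (scalarize A (v + w) - (scalarize A v + scalarize A w)) / 4"
  define a where "a = scalarize A v + e"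
  define b where "b = scalarize A w + e"
  have e: "e > 0" "4 * e = scalarize A (v + w) - (scalarize A v + scalarize A w)"
    using * by (simp_all add: e_def)
  then have ab: "a > 0" "b > 0" "scalarize A v < a" "scalarize A w < b" "a + b < scalarize A (v + w)"
    using scalarize_nonneg[of v] scalarize_nonneg[of w] e unfolding a_def b_def by linarith+
  have "(1/a) *\<^sub>R v \<in> - A" "(1/b) *\<^sub>R w \<in> - A"
    using scalarize_gt_iff[of a v] scalarize_gt_iff[of b w] ab by (auto simp: scaled_set_iff)
  moreover have "convex (- A)" using A by (simp add: family_R_def)
  ultimately have "(a/(a+b)) *\<^sub>R ((1/a) *\<^sub>R v) + (b/(a+b)) *\<^sub>R ((1/b) *\<^sub>R w) \<in> - A"
    using ab by (intro convexD) (auto simp: add_divide_distrib[symmetric])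
  moreover have "(a/(a+b)) *\<^sub>R ((1/a) *\<^sub>R v) + (b/(a+b)) *\<^sub>R ((1/b) *\<^sub>R w) = (1/(a+b)) *\<^sub>R (v + w)"
    using ab by (simp add: scaleR_add_right)
  ultimately show False
    using scalarize_gt_iff[of "a+b" "v+w"] ab by (auto simp: scaled_set_iff)
qed

lemma scalarize_sum: "scalarize A (\<Sum>i\<in>I. v i) \<le> (\<Sum>i\<in>I. scalarize A (v i))"
proof (induction I rule: infinite_finite_induct)
  case (insert i I)
  then show ?case using scalarize_add[of "v i" "\<Sum>i\<in>I. v i"] by simp
qed (auto simp: scalarize_zero)

lemma scalarize_mono:
  assumes "\<And>k. 0 \<le> w $ k"
  shows "scalarize A v \<le> scalarize A (v + w)"
proof (rule ccontr)
  assume "\<not> ?thesis"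
  then obtain x where x: "scalarize A (v + w) < x" "x < scalarize A v"
    by (meson dense not_le)
  then have "x > 0" using scalarize_nonneg[of "v + w"] by linarith
  then have "(1/x) *\<^sub>R v \<in> A" using x scalarize_gt_iff[of x v] by (simp add: scaled_set_iff)
  then have "(1/x) *\<^sub>R v + (1/x) *\<^sub>R w \<in> A"
    using A assms \<open>x > 0\<close> by (auto simp: family_R_def increasing_set_def)
  then have "x < scalarize A (v + w)"
    using \<open>x > 0\<close> scalarize_gt_iff[of x "v + w"] by (simp add: scaled_set_iff scaleR_add_right)
  with x show False by simp
qed

end

subsection \<open>Consistently varying tails\<close>

lemma tail_nonneg: "prob_space G \<Longrightarrow> 0 \<le> tail G x"
  by (simp add: tail_def cdf_def prob_space.prob_le_1)

lemma tail_le_1: "tail G x \<le> 1"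
  by (simp add: tail_def cdf_def)

lemma tail_antimono:
  assumes "prob_space G" "sets G = sets borel" "x \<le> y"
  shows "tail G y \<le> tail G x"
proof -
  interpret prob_space G by fact
  show ?thesis using assms unfolding tail_def cdf_def
    by (simp add: finite_measure_mono)
qed

lemma (in prob_space) tail_distr:
  assumes "Z \<in> borel_measurable M"
  shows "tail (distr M borel Z) x = prob {\<omega>\<in>space M. x < Z \<omega>}"
proof -
  have "cdf (distr M borel Z) x = prob {\<omega>\<in>space M. Z \<omega> \<le> x}"
    using assms unfolding cdf_def by (subst measure_distr) (auto intro!: arg_cong[where f=prob])
  moreover have "{\<omega>\<in>space M. Z \<omega> \<le> x} = space M - {\<omega>\<in>space M. x < Z \<omega>}" by auto
  moreover have "{\<omega>\<in>space M. x < Z \<omega>} \<in> events" using assms by measurable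
  ultimately show ?thesis by (simp add: tail_def prob_compl)
qed

lemma consistently_varying_ratio:
  assumes "consistently_varying G" "\<epsilon> > 0"
  obtains b where "0 < b" "b < 1" "eventually (\<lambda>x. tail G (b * x) \<le> (1 + \<epsilon>) * tail G x) at_top"
proof -
  let ?L = "\<lambda>b. Limsup at_top (\<lambda>x. ereal (tail G (b * x) / tail G x))"
  have pos: "tail G x > 0" if "x \<ge> 0" for x using assms that by (simp add: consistently_varying_def)
  have "(?L \<longlongrightarrow> 1) (at_left 1)" using assms by (simp add: consistently_varying_def)
  moreover have "(1::ereal) < ereal (1 + \<epsilon>)" using assms(2) by (simp add: one_ereal_def)
  ultimately have "eventually (\<lambda>b. ?L b < ereal (1 + \<epsilon>)) (at_left 1)" by (rule order_tendstoD)
  moreover have "eventually (\<lambda>b::real. b \<in> {0<..<1}) (at_left 1)"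
    by (rule eventually_at_left_real) simp
  ultimately have "eventually (\<lambda>b. ?L b < ereal (1 + \<epsilon>) \<and> b \<in> {0<..<1}) (at_left 1)"
    by (rule eventually_conj)
  then obtain b where b: "?L b < ereal (1 + \<epsilon>)" "b \<in> {0<..<1}"
    using eventually_happens' trivial_limit_at_left_real by blast
  from Limsup_lessD[OF b(1)] have "eventually (\<lambda>x. tail G (b * x) / tail G x < 1 + \<epsilon>) at_top"
    by simp
  then have "eventually (\<lambda>x. tail G (b * x) \<le> (1 + \<epsilon>) * tail G x) at_top"
    using eventually_ge_at_top[of 0]
  proof eventually_elim
    case (elim x)
    then show ?case using pos[of x] by (simp add: pos_divide_less_eq)
  qed
  then show thesis using b by (intro that[of b]) auto
qed

text \<open>Iterating a single inequality \<open>tail G (b * x) \<le> 2 * tail G x\<close> gives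
  polynomial growth in \<open>y\<close>. The bound is stated for all \<open>x \<ge> 0\<close>, not
  just large ones, because it is later summed over scales that grow with the number of
  claims.\<close>

lemma tail_Potter_bound:
  assumes "consistently_varying G"
  obtains C p where "0 < C" "\<And>x y. 0 \<le> x \<Longrightarrow> 1 \<le> y \<Longrightarrow> tail G (x / y) \<le> C * y ^ p * tail G x"
proof -
  have G: "prob_space G" "sets G = sets borel" and pos: "\<And>x. x \<ge> 0 \<Longrightarrow> tail G x > 0"
    using assms by (auto simp: consistently_varying_def)
  obtain b where b: "0 < b" "b < 1"
    and ev: "eventually (\<lambda>x. tail G (b * x) \<le> (1 + 1) * tail G x) at_top"
    using consistently_varying_ratio[OF assms zero_less_one] by blast
  then obtain x0 where "\<forall>x\<ge>x0. tail G (b * x) \<le> 2 * tail G x"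
    unfolding eventually_at_top_linorder one_add_one by blast
  then have dbl: "tail G (b * x) \<le> 2 * tail G x" if "x \<ge> max 0 x0" for x
    using that max.cobounded2 order_trans by metis
  define C where "C = max 2 (1 / tail G (max 0 x0))"
  have C: "C \<ge> 2" by (simp add: C_def)
  have small: "tail G z \<le> C * tail G x" if "0 \<le> x" "x \<le> max 0 x0" for x z
  proof -
    have "tail G z \<le> 1" by (rule tail_le_1)
    also have "\<dots> = 1 / tail G (max 0 x0) * tail G (max 0 x0)" using pos[of "max 0 x0"] by simp
    also have "\<dots> \<le> C * tail G x"
      using that G pos[of "max 0 x0"] C
      by (intro mult_mono tail_antimono) (auto simp: C_def)
    finally show ?thesis .
  qed
  \<comment> \<open>With this exponent the factor 2 lost in one step is absorbed by
    \<open>b ^ p\<close>, so \<open>C\<close> does not grow along the induction.\<close>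
  obtain p where p: "b ^ p < 1 / 2" using real_arch_pow_inv[of "1/2" b] b(2) by (meson half_gt_zero zero_less_one)
  \<comment> \<open>\<open>k\<close> bounds the number of steps by the factor \<open>b\<close> that
    take \<open>x\<close> down to \<open>x / y\<close>. When \<open>y * b < 1\<close>, one step
    already passes \<open>x / y\<close>.\<close>
  have main: "tail G (x / y) \<le> C * y ^ p * tail G x" if "0 \<le> x" "1 \<le> y" "y * b ^ k \<le> 1" for k x y
    using that
  proof (induction k arbitrary: x y)
    case 0
    then have "y = 1" by simp
    then show ?case using C pos[OF 0(1)] by simp
  next
    case (Suc k)
    have y: "1 \<le> y ^ p" using Suc.prems by simp
    consider "x \<le> max 0 x0" | "x \<ge> max 0 x0" "y * b \<ge> 1" | "x \<ge> max 0 x0" "y * b < 1"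
      by linarith
    then show ?case
    proof cases
      case 1
      have "tail G (x / y) \<le> C * 1 * tail G x" using small[of x "x / y"] Suc.prems 1 by simp
      also have "\<dots> \<le> C * y ^ p * tail G x"
        using C y pos[OF Suc(2)] by (intro mult_right_mono mult_left_mono) auto
      finally show ?thesis .
    next
      case 2
      have "tail G (b * x / (y * b)) \<le> C * (y * b) ^ p * tail G (b * x)"
        using Suc.prems b 2 by (intro Suc.IH) (auto simp: mult.assoc)
      also have "\<dots> \<le> C * (y * b) ^ p * (2 * tail G x)"
        using dbl[OF 2(1)] C Suc.prems b by (intro mult_left_mono) auto
      also have "\<dots> = (C * y ^ p * tail G x) * (2 * b ^ p)" by (simp add: power_mult_distrib)
      also have "\<dots> \<le> (C * y ^ p * tail G x) * 1"
        using p C y pos[OF Suc(2)] by (intro mult_left_mono) auto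
      finally show ?thesis using b by simp
    next
      case 3
      have "tail G (x / y) \<le> tail G (b * x)"
      proof (rule tail_antimono[OF G])
        have "x * (y * b) \<le> x * 1" using 3 Suc.prems by (intro mult_left_mono) auto
        then show "b * x \<le> x / y" using Suc.prems by (simp add: field_simps)
      qed
      also have "\<dots> \<le> 2 * tail G x" using dbl 3 by simp
      also have "\<dots> \<le> (C * y ^ p) * tail G x"
        using C y pos[OF Suc(2)] mult_mono[of 2 C 1 "y ^ p"] by (intro mult_right_mono) auto
      finally show ?thesis .
    qed
  qed
  have "tail G (x / y) \<le> C * y ^ p * tail G x" if xy: "0 \<le> x" "1 \<le> y" for x y
  proof -
    obtain k where "b ^ k < 1 / y" using real_arch_pow_inv[of "1/y" b] b(2) xy(2)
      by (meson divide_pos_pos less_le_trans zero_less_one)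
    then have "y * b ^ k \<le> 1" using xy by (simp add: field_simps)
    then show ?thesis using main xy by blast
  qed
  then show thesis using C by (intro that[of C p]) auto
qed

subsection \<open>Randomly weighted sums of quasi-asymptotically independent claims\<close>

text \<open>Independence turns the joint law into a product, and Tonelli fixes the value of
  \<open>c\<close>. Where \<open>c\<close> vanishes the event is empty because \<open>x > 0\<close>;
  the conditional avoids the quotient \<open>x / 0\<close>.\<close>

lemma (in prob_space) emeasure_product_gt:
  fixes c Z :: "'a \<Rightarrow> real"
  assumes "indep_var borel c borel Z" "0 < x"
    and nonneg: "\<And>\<omega>. \<omega> \<in> space M \<Longrightarrow> 0 \<le> c \<omega>" "\<And>\<omega>. \<omega> \<in> space M \<Longrightarrow> 0 \<le> Z \<omega>"
  shows "emeasure M {\<omega>\<in>space M. x < c \<omega> * Z \<omega>} =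
    (\<integral>\<^sup>+\<omega>. ennreal (if 0 < c \<omega> then tail (distr M borel Z) (x / c \<omega>) else 0) \<partial>M)"
proof -
  have [measurable]: "c \<in> borel_measurable M" "Z \<in> borel_measurable M"
    using indep_var_rv1[OF assms(1)] indep_var_rv2[OF assms(1)] by auto
  interpret Z: prob_space "distr M borel Z" by (rule prob_space_distr) simp
  define B where "B = {p :: real \<times> real. x < fst p * snd p}"
  have "B = {p \<in> space (borel \<Otimes>\<^sub>M borel). x < fst p * snd p}"
    by (auto simp: B_def space_pair_measure)
  also have "\<dots> \<in> sets (borel \<Otimes>\<^sub>M borel)" by measurable
  finally have B[measurable]: "B \<in> sets (borel \<Otimes>\<^sub>M borel)" .
  have eq: "distr M borel c \<Otimes>\<^sub>M distr M borel Z = distr M (borel \<Otimes>\<^sub>M borel) (\<lambda>\<omega>. (c \<omega>, Z \<omega>))"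
    using assms(1) by (simp add: indep_var_distribution_eq)
  have "emeasure M {\<omega>\<in>space M. x < c \<omega> * Z \<omega>} =
      emeasure (distr M (borel \<Otimes>\<^sub>M borel) (\<lambda>\<omega>. (c \<omega>, Z \<omega>))) B"
    by (subst emeasure_distr[OF _ B])
      (simp, auto simp: B_def intro!: arg_cong[where f="emeasure M"])
  also have "\<dots> = (\<integral>\<^sup>+a. emeasure (distr M borel Z) (Pair a -` B) \<partial>distr M borel c)"
    unfolding eq[symmetric] by (rule Z.emeasure_pair_measure_alt) simp
  also have "\<dots> = (\<integral>\<^sup>+\<omega>. emeasure (distr M borel Z) (Pair (c \<omega>) -` B) \<partial>M)"
  proof -
    have "(\<lambda>a. emeasure (distr M borel Z) (Pair a -` B)) \<in> borel_measurable borel"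
      by (rule Z.measurable_emeasure_Pair) simp
    then show ?thesis by (simp add: nn_integral_distr)
  qed
  also have "\<dots> = (\<integral>\<^sup>+\<omega>. ennreal (if 0 < c \<omega> then tail (distr M borel Z) (x / c \<omega>) else 0) \<partial>M)"
  proof (rule nn_integral_cong)
    fix \<omega> assume \<omega>: "\<omega> \<in> space M"
    have sec: "Pair (c \<omega>) -` B = {z. x < c \<omega> * z}" by (auto simp: B_def)
    have "emeasure (distr M borel Z) {z. x < c \<omega> * z} = prob {\<omega>'\<in>space M. x < c \<omega> * Z \<omega>'}"
      by (subst emeasure_distr) (auto simp: emeasure_eq_measure intro!: arg_cong[where f=prob])
    also have "\<dots> = (if 0 < c \<omega> then tail (distr M borel Z) (x / c \<omega>) else 0)"
    proof (cases "0 < c \<omega>")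
      case True
      then have "{\<omega>'\<in>space M. x < c \<omega> * Z \<omega>'} = {\<omega>'\<in>space M. x / c \<omega> < Z \<omega>'}"
        by (auto simp: field_simps)
      then show ?thesis using True by (simp add: tail_distr)
    next
      case False
      then have "c \<omega> = 0" using nonneg(1)[OF \<omega>] by simp
      then show ?thesis using assms(2) by simp
    qed
    finally show "emeasure (distr M borel Z) (Pair (c \<omega>) -` B) =
      ennreal (if 0 < c \<omega> then tail (distr M borel Z) (x / c \<omega>) else 0)" by (simp add: sec)
  qed
  finally show ?thesis .
qed

lemma (in prob_space) Bonferroni_lower:
  fixes B :: "nat \<Rightarrow> 'a set"
  assumes "\<And>i. B i \<in> events"
  shows "(\<Sum>i<m. prob (B i)) \<le> prob (\<Union>i<m. B i) + (\<Sum>i<m. \<Sum>j<i. prob (B i \<inter> B j))"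
proof (induction m)
  case (Suc m)
  let ?U = "\<Union>i<m. B i"
  have U: "?U \<in> events" using assms by auto
  have "prob (B m \<inter> ?U) = prob (\<Union>j<m. B m \<inter> B j)" by (simp only: Int_UN_distrib)
  also have "\<dots> \<le> (\<Sum>j<m. prob (B m \<inter> B j))"
    using assms by (intro finite_measure_subadditive_finite) auto
  finally have "prob (B m \<inter> ?U) \<le> (\<Sum>j<m. prob (B m \<inter> B j))" .
  moreover have "prob (B m \<union> ?U) = prob (B m) + prob (?U - B m)"
    using U assms by (intro finite_measure_Union') auto
  moreover have "prob (?U - B m) = prob ?U - prob (?U \<inter> B m)"
    using U assms by (intro finite_measure_Diff') auto
  moreover have "(\<Union>i<Suc m. B i) = B m \<union> ?U" by (auto simp: lessThan_Suc)
  ultimately show ?case using Suc by (simp add: Int_commute)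
qed simp

text \<open>Otherwise at most one term exceeds \<open>(1 - b) * x / m\<close>, and that one is at
  most \<open>b * x\<close>. The remaining terms add at most \<open>(1 - b) * x\<close>, so the sum
  cannot exceed \<open>x\<close>.\<close>

lemma sum_gt_one_big_or_two_large:
  fixes y :: "nat \<Rightarrow> real"
  assumes "x < (\<Sum>i<m. y i)" "0 < x" "0 < b" "b < 1"
  shows "(\<exists>i<m. b * x < y i) \<or> (\<exists>i<m. \<exists>j<i. (1 - b) * x / m < y i \<and> (1 - b) * x / m < y j)"
proof (rule ccontr)
  let ?a = "(1 - b) * x / m"
  assume "\<not> ?thesis"
  then have small: "\<And>i. i < m \<Longrightarrow> y i \<le> b * x"
    and pair: "\<And>i j. i < m \<Longrightarrow> j < i \<Longrightarrow> y i \<le> ?a \<or> y j \<le> ?a"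
    by (meson not_less)+
  have m: "0 < m" using assms by (cases m) auto
  have "0 < ?a" using assms m by simp
  have ma: "m * ?a = (1 - b) * x" using m by simp
  have "(\<Sum>i<m. y i) \<le> x"
  proof (cases "\<exists>i0<m. ?a < y i0")
    case True
    then obtain i0 where i0: "i0 < m" "?a < y i0" by blast
    have "y i \<le> ?a" if "i < m" "i \<noteq> i0" for i
      using pair[of i i0] pair[of i0 i] that i0 by (cases "i < i0") auto
    then have "(\<Sum>i\<in>{..<m} - {i0}. y i) \<le> card ({..<m} - {i0}) * ?a"
      by (intro sum_bounded_above) auto
    also have "\<dots> \<le> m * ?a"
      using \<open>0 < ?a\<close> i0 by (intro mult_right_mono) auto
    finally have "(\<Sum>i<m. y i) \<le> y i0 + (1 - b) * x"
      using i0 unfolding ma by (subst sum.remove[of _ i0]) auto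
    also have "\<dots> \<le> x" using small[OF i0(1)] by (simp add: algebra_simps)
    finally show ?thesis .
  next
    case False
    then have "y i \<le> ?a" if "i < m" for i using that not_less by blast
    then have "(\<Sum>i<m. y i) \<le> card {..<m} * ?a" by (intro sum_bounded_above) simp
    also have "\<dots> = (1 - b) * x" using ma by simp
    also have "\<dots> \<le> x" using assms by (simp add: algebra_simps)
    finally show ?thesis .
  qed
  with assms(1) show False by simp
qed

text \<open>The time structure is abstracted away. \<open>E i\<close> stands for the event that
  claim \<open>i\<close>, counted from 0, arrives before the horizon, and \<open>E_moments\<close>
  says that the number of claims has moments of all orders. The assumptions allow dependence among
  the \<open>Z i\<close> and among the weights.\<close>

locale randomly_weighted_claims = prob_space M
  for M :: "'a measure" +
  fixes Z c :: "nat \<Rightarrow> 'a \<Rightarrow> real"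
    and E :: "nat \<Rightarrow> 'a set"
    and G :: "real measure"
    and \<kappa> :: real
  assumes Z_measurable[measurable]: "Z i \<in> borel_measurable M"
    and Z_nonneg: "\<omega> \<in> space M \<Longrightarrow> 0 \<le> Z i \<omega>"
    and Z_distr: "distr M borel (Z i) = G"
    and G_consistent: "consistently_varying G"
    and c_Z_indep: "indep_var borel (c i) borel (Z i)"
    and c_nonneg: "\<omega> \<in> space M \<Longrightarrow> 0 \<le> c i \<omega>"
    and c_zero: "\<omega> \<in> space M \<Longrightarrow> \<omega> \<notin> E i \<Longrightarrow> c i \<omega> = 0"
    and c_bound: "AE \<omega> in M. c i \<omega> \<le> \<kappa>"
    and kappa_ge_1: "1 \<le> \<kappa>"
    and c_0_nontrivial: "0 < prob {\<omega>\<in>space M. 0 < c 0 \<omega>}"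
    and E_event[measurable]: "E i \<in> events"
    and E_decreasing: "E (Suc i) \<subseteq> E i"
    and E_Z_indep: "prob (E n \<inter> {\<omega>\<in>space M. x < Z i \<omega>}) = prob (E n) * tail G x"
    and E_moments: "summable (\<lambda>n. real (Suc n) ^ p * prob (E n))"
    and Z_QAI: "QAI M UNIV Z"
begin

definition Y :: "nat \<Rightarrow> 'a \<Rightarrow> real" where
  "Y i \<omega> = c i \<omega> * Z i \<omega>"

definition Y_tail :: "nat \<Rightarrow> real \<Rightarrow> real" where
  "Y_tail i x = prob {\<omega>\<in>space M. x < Y i \<omega>}"

lemma c_measurable[measurable]: "c i \<in> borel_measurable M"
  by (rule indep_var_rv1[OF c_Z_indep])

lemma Y_measurable[measurable]: "Y i \<in> borel_measurable M"
  unfolding Y_def[abs_def] by measurable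

lemma Y_nonneg: "\<omega> \<in> space M \<Longrightarrow> 0 \<le> Y i \<omega>"
  by (simp add: Y_def c_nonneg Z_nonneg)

lemma G_prob: "prob_space G" and G_sets: "sets G = sets borel"
  and tail_pos: "0 \<le> x \<Longrightarrow> 0 < tail G x"
  using G_consistent by (auto simp: consistently_varying_def)

lemma tail_G: "tail G x = prob {\<omega>\<in>space M. x < Z i \<omega>}"
  using tail_distr[OF Z_measurable, of i x] by (simp add: Z_distr)

lemma E_mono: "i \<le> j \<Longrightarrow> E j \<subseteq> E i"
  using E_decreasing by (rule lift_Suc_antimono_le)

section \<open>Tails of single weighted claims\<close>

lemma Y_tail_eq:
  assumes "0 < x"
  shows "ennreal (Y_tail i x) =
    (\<integral>\<^sup>+\<omega>. ennreal (if 0 < c i \<omega> then tail G (x / c i \<omega>) else 0) \<partial>M)"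
  using emeasure_product_gt[OF c_Z_indep assms c_nonneg Z_nonneg, of i]
  unfolding Y_tail_def Y_def Z_distr by (simp only: emeasure_eq_measure)

lemma tail_G_measurable[measurable]: "tail G \<in> borel_measurable borel"
proof -
  interpret G: prob_space G by (rule G_prob)
  have "mono (cdf G)"
    unfolding cdf_def mono_def using G_sets by (simp add: G.finite_measure_mono)
  then have "cdf G \<in> borel_measurable borel" by (rule borel_measurable_mono)
  then show ?thesis unfolding tail_def[abs_def] by simp
qed

text \<open>The tail inequality is applied under the integral at
  \<open>y = x / c i \<omega>\<close>. Bounded weights are essential here:
  \<open>c i \<omega> \<le> \<kappa>\<close> keeps this point above \<open>y0\<close> uniformly in
  \<omega> and \<open>i\<close>.\<close>

lemma Y_tail_shrink:
  assumes "\<And>y. y0 \<le> y \<Longrightarrow> tail G (b * y) \<le> r * tail G y"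
    and "0 \<le> r" "0 < b" "0 < x" "y0 * \<kappa> \<le> x" "0 \<le> y0"
  shows "Y_tail i (b * x) \<le> r * Y_tail i x"
proof -
  have "ennreal (Y_tail i (b * x)) =
      (\<integral>\<^sup>+\<omega>. ennreal (if 0 < c i \<omega> then tail G (b * x / c i \<omega>) else 0) \<partial>M)"
    using assms by (intro Y_tail_eq) simp
  also have "\<dots> \<le> (\<integral>\<^sup>+\<omega>. ennreal r * ennreal (if 0 < c i \<omega> then tail G (x / c i \<omega>) else 0) \<partial>M)"
  proof (rule nn_integral_mono_AE, use c_bound[of i] in eventually_elim)
    fix \<omega> assume \<omega>: "c i \<omega> \<le> \<kappa>"
    show "ennreal (if 0 < c i \<omega> then tail G (b * x / c i \<omega>) else 0) \<le>
        ennreal r * ennreal (if 0 < c i \<omega> then tail G (x / c i \<omega>) else 0)"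
    proof (cases "0 < c i \<omega>")
      case True
      have "y0 * c i \<omega> \<le> y0 * \<kappa>" using \<omega> assms by (intro mult_left_mono) auto
      then have "y0 \<le> x / c i \<omega>" using True assms by (simp add: field_simps)
      from assms(1)[OF this] show ?thesis
        using True tail_nonneg[OF G_prob] assms(2) by (simp add: ennreal_mult'[symmetric])
    qed simp
  qed
  also have "\<dots> = ennreal r * ennreal (Y_tail i x)"
    by (subst nn_integral_cmult) (simp_all add: Y_tail_eq assms)
  also have "\<dots> = ennreal (r * Y_tail i x)"
    using assms by (simp add: ennreal_mult'[symmetric])
  finally show ?thesis
    using assms by (subst (asm) ennreal_le_iff) (auto simp: Y_tail_def)
qed

lemma Y_tail_le: "Y_tail i x \<le> prob (E i) * tail G (x / \<kappa>)" if "0 < x"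
proof -
  have "Y_tail i x \<le> prob (E i \<inter> {\<omega>\<in>space M. x / \<kappa> < Z i \<omega>})"
    unfolding Y_tail_def
  proof (rule finite_measure_mono_AE)
    show "AE \<omega> in M. \<omega> \<in> {\<omega>\<in>space M. x < Y i \<omega>} \<longrightarrow>
        \<omega> \<in> E i \<inter> {\<omega>\<in>space M. x / \<kappa> < Z i \<omega>}"
      using c_bound[of i]
    proof eventually_elim
      case (elim \<omega>)
      show ?case
      proof
        assume "\<omega> \<in> {\<omega>\<in>space M. x < Y i \<omega>}"
        then have \<omega>: "\<omega> \<in> space M" "x < c i \<omega> * Z i \<omega>" by (auto simp: Y_def)
        have "c i \<omega> * Z i \<omega> \<le> \<kappa> * Z i \<omega>"
          using elim Z_nonneg \<omega> by (intro mult_right_mono) auto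
        then have "x / \<kappa> < Z i \<omega>" using \<omega> kappa_ge_1 by (simp add: field_simps)
        moreover have "\<omega> \<in> E i" using c_zero[OF \<omega>(1), of i] \<omega>(2) that
          by (cases "\<omega> \<in> E i") simp_all
        ultimately show "\<omega> \<in> E i \<inter> {\<omega>\<in>space M. x / \<kappa> < Z i \<omega>}" using \<omega> by simp
      qed
    qed
  qed measurable
  then show ?thesis by (simp add: E_Z_indep)
qed

lemma summable_E: "summable (\<lambda>n. prob (E n))"
  using E_moments[of 0] by simp

text \<open>The Potter bound removes the scale \<kappa>. Retaining the factor
  \<open>prob (E i)\<close> makes the bound summable over \<open>i\<close>.\<close>

lemma Y_tail_bounds:
  obtains C where "0 < C" "\<And>i x. 0 < x \<Longrightarrow> Y_tail i x \<le> C * prob (E i) * tail G x"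
proof -
  obtain C p where C: "0 < C"
    "\<And>x y. 0 \<le> x \<Longrightarrow> 1 \<le> y \<Longrightarrow> tail G (x / y) \<le> C * y ^ p * tail G x"
    using tail_Potter_bound[OF G_consistent] by blast
  have "Y_tail i x \<le> (C * \<kappa> ^ p) * prob (E i) * tail G x" if "0 < x" for i x
  proof -
    have "Y_tail i x \<le> prob (E i) * tail G (x / \<kappa>)" using that by (rule Y_tail_le)
    also have "\<dots> \<le> prob (E i) * (C * \<kappa> ^ p * tail G x)"
      using that kappa_ge_1 by (intro mult_left_mono C(2)) auto
    finally show ?thesis by (simp add: mult_ac)
  qed
  moreover have "0 < C * \<kappa> ^ p" using C(1) kappa_ge_1 by simp
  ultimately show thesis by (intro that)
qed

lemma summable_Y_tail:
  assumes "0 < x"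
  shows "summable (\<lambda>i. Y_tail i x)"
proof -
  obtain C where "0 < C" and C: "\<And>i x. 0 < x \<Longrightarrow> Y_tail i x \<le> C * prob (E i) * tail G x"
    using Y_tail_bounds by blast
  show ?thesis
  proof (rule summable_comparison_test')
    show "summable (\<lambda>i. C * prob (E i) * tail G x)"
      by (intro summable_mult2 summable_mult summable_E)
    show "norm (Y_tail i x) \<le> C * prob (E i) * tail G x" if "0 \<le> i" for i
      using C[OF assms, of i] by (simp add: Y_tail_def)
  qed
qed

text \<open>This converts errors relative to \<open>tail G x\<close> into errors relative to the
  denominator. The term \<open>i = 0\<close> suffices, since its weight is bounded away from 0 with
  positive probability.\<close>

lemma Y_tail_lower:
  obtains C where "0 < C" "\<And>x. 0 < x \<Longrightarrow> tail G x \<le> C * (\<Sum>i. Y_tail i x)"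
proof -
  obtain C p where C: "0 < C"
    "\<And>x y. 0 \<le> x \<Longrightarrow> 1 \<le> y \<Longrightarrow> tail G (x / y) \<le> C * y ^ p * tail G x"
    using tail_Potter_bound[OF G_consistent] by blast
  \<comment> \<open>\<open>{c 0 > 0}\<close> is the countable union of the events
    \<open>{c 0 > 1 / (n + 1)}\<close>, so they cannot all be null.\<close>
  have "\<exists>n. 0 < prob {\<omega>\<in>space M. 1 / Suc n < c 0 \<omega>}"
  proof (rule ccontr)
    assume "\<nexists>n. 0 < prob {\<omega>\<in>space M. 1 / Suc n < c 0 \<omega>}"
    then have 0: "prob {\<omega>\<in>space M. 1 / Suc n < c 0 \<omega>} = 0" for n
      using measure_nonneg antisym not_less by metis
    have "AE \<omega> in M. \<forall>n. \<not> 1 / real (Suc n) < c 0 \<omega>"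
      unfolding AE_all_countable
    proof
      fix n
      have "{\<omega>\<in>space M. 1 / real (Suc n) < c 0 \<omega>} \<in> events" by measurable
      from prob_eq_0[OF this] 0[of n] show "AE \<omega> in M. \<not> 1 / real (Suc n) < c 0 \<omega>" by simp
    qed
    then have "AE \<omega> in M. \<not> 0 < c 0 \<omega>"
    proof eventually_elim
      case (elim \<omega>)
      show ?case
      proof
        assume "0 < c 0 \<omega>"
        then obtain n where "inverse (real (Suc n)) < c 0 \<omega>" using reals_Archimedean by blast
        with elim show False by (simp add: inverse_eq_divide)
      qed
    qed
    moreover have "{\<omega>\<in>space M. 0 < c 0 \<omega>} \<in> events" by measurable
    ultimately have "prob {\<omega>\<in>space M. 0 < c 0 \<omega>} = 0" by (subst prob_eq_0) auto
    with c_0_nontrivial show False by simp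
  qed
  then obtain n where n: "0 < prob {\<omega>\<in>space M. 1 / Suc n < c 0 \<omega>}" (is "0 < ?q") ..
  let ?s = "real (Suc n)"
  have "tail G x \<le> (C * ?s ^ p / ?q) * (\<Sum>i. Y_tail i x)" if x: "0 < x" for x
  proof -
    have "?q * tail G (?s * x) = prob ({\<omega>\<in>space M. 1 / Suc n < c 0 \<omega>} \<inter> {\<omega>\<in>space M. ?s * x < Z 0 \<omega>})"
    proof -
      have "prob ((\<lambda>\<omega>. (c 0 \<omega>, Z 0 \<omega>)) -` ({1 / ?s<..} \<times> {?s * x<..}) \<inter> space M) =
          prob (c 0 -` {1 / ?s<..} \<inter> space M) * prob (Z 0 -` {?s * x<..} \<inter> space M)"
        by (rule indep_varD[OF c_Z_indep]) auto
      then show ?thesis by (simp add: tail_G[of _ 0] vimage_def Int_def conj_commute conj_left_commute)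
    qed
    also have "\<dots> \<le> Y_tail 0 x"
      unfolding Y_tail_def
    proof (rule finite_measure_mono)
      show "{\<omega>\<in>space M. 1 / Suc n < c 0 \<omega>} \<inter> {\<omega>\<in>space M. ?s * x < Z 0 \<omega>}
          \<subseteq> {\<omega>\<in>space M. x < Y 0 \<omega>}"
      proof safe
        fix \<omega> assume \<omega>: "1 / Suc n < c 0 \<omega>" "?s * x < Z 0 \<omega>"
        have "x = (1 / Suc n) * (?s * x)" by simp
        also have "\<dots> < c 0 \<omega> * Z 0 \<omega>"
        proof (rule mult_strict_mono[OF \<omega>])
          show "0 < c 0 \<omega>" by (rule less_trans[OF _ \<omega>(1)]) simp
          show "0 \<le> ?s * x" using x by simp
        qed
        finally show "x < Y 0 \<omega>" by (simp add: Y_def)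
      qed
    qed measurable
    also have "\<dots> \<le> (\<Sum>i. Y_tail i x)"
      using sum_le_suminf[OF summable_Y_tail[OF x], of "{0}"] by (simp add: Y_tail_def)
    finally have 1: "?q * tail G (?s * x) \<le> (\<Sum>i. Y_tail i x)" .
    have "tail G x = tail G (?s * x / ?s)" by simp
    also have "\<dots> \<le> C * ?s ^ p * tail G (?s * x)" using x by (intro C(2)) auto
    also have "\<dots> \<le> C * ?s ^ p * ((\<Sum>i. Y_tail i x) / ?q)"
      using 1 n C(1) by (intro mult_left_mono) (auto simp: field_simps)
    finally show ?thesis by simp
  qed
  moreover have "0 < C * ?s ^ p / ?q" using n C(1) by simp
  ultimately show thesis by (intro that)
qed

section \<open>Two large claims, and the first \<open>m\<close> claims\<close>

lemma joint_tail_negligible: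
  assumes "i \<noteq> j" "0 < a" "0 < \<epsilon>"
  shows "eventually (\<lambda>x. prob ({\<omega>\<in>space M. a * x < Z i \<omega>} \<inter> {\<omega>\<in>space M. a * x < Z j \<omega>})
    \<le> \<epsilon> * tail G x) at_top"
proof -
  obtain C p where C: "0 < C"
    "\<And>x y. 0 \<le> x \<Longrightarrow> 1 \<le> y \<Longrightarrow> tail G (x / y) \<le> C * y ^ p * tail G x"
    using tail_Potter_bound[OF G_consistent] by blast
  \<comment> \<open>The Potter bound asks for a divisor of at least 1, and
    \<open>x / y \<le> a * x\<close> is what transfers the bound from \<open>a * x\<close> back to
    \<open>x\<close>.\<close>
  define y where "y = max 1 (1 / a)"
  have y: "1 \<le> y" "1 / y \<le> a" using assms by (auto simp: y_def max_def field_simps)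
  \<comment> \<open>The 2 accounts for the two equal tails in the denominator of the
    quasi-asymptotic independence ratio.\<close>
  define \<delta> where "\<delta> = \<epsilon> / (2 * C * y ^ p)"
  have \<delta>: "0 < \<delta>" using assms C y by (simp add: \<delta>_def)
  let ?J = "\<lambda>x. prob {\<omega>\<in>space M. Z i \<omega> > x \<and> Z j \<omega> > x}"
  have "((\<lambda>x. ?J x / (tail G x + tail G x)) \<longlongrightarrow> 0) at_top"
    using Z_QAI assms(1) by (simp add: QAI_def Z_distr)
  then have "eventually (\<lambda>x. ?J x / (tail G x + tail G x) < \<delta>) at_top"
    using \<delta> by (rule order_tendstoD)
  then have "eventually (\<lambda>x. ?J x / (tail G x + tail G x) < \<delta> \<and> 0 \<le> x) at_top"
    using eventually_ge_at_top[of 0] by (rule eventually_conj)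
  moreover have "filterlim (\<lambda>x. a * x) at_top at_top"
    using assms by (intro filterlim_tendsto_pos_mult_at_top[of _ a]) (auto intro: filterlim_ident)
  ultimately have "eventually (\<lambda>x. ?J (a * x) / (tail G (a * x) + tail G (a * x)) < \<delta> \<and> 0 \<le> a * x) at_top"
    by (rule eventually_compose_filterlim)
  then show ?thesis
  proof eventually_elim
    case (elim x)
    then have x: "0 \<le> x" using assms by (simp add: zero_le_mult_iff)
    have "prob ({\<omega>\<in>space M. a * x < Z i \<omega>} \<inter> {\<omega>\<in>space M. a * x < Z j \<omega>}) = ?J (a * x)"
      by (rule arg_cong[where f=prob]) auto
    also have "\<dots> \<le> \<delta> * (2 * tail G (a * x))"
      using elim tail_pos[of "a * x"] by (simp add: field_simps)
    also have "\<dots> \<le> \<delta> * (2 * tail G (x / y))"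
    proof -
      have "x * (1 / y) \<le> x * a" using x y by (intro mult_left_mono) auto
      then show ?thesis using \<delta> by (simp add: tail_antimono G_prob G_sets mult.commute)
    qed
    also have "\<dots> \<le> \<delta> * (2 * (C * y ^ p * tail G x))"
      using \<delta> C x y by (intro mult_left_mono C(2)) auto
    also have "\<dots> = \<epsilon> * tail G x" using C y by (simp add: \<delta>_def)
    finally show ?case .
  qed
qed

definition pair_tail :: "nat \<Rightarrow> real \<Rightarrow> real" where
  "pair_tail m x =
    (\<Sum>i<m. \<Sum>j<i. prob ({\<omega>\<in>space M. x < Y i \<omega>} \<inter> {\<omega>\<in>space M. x < Y j \<omega>}))"

lemma pair_tail_negligible:
  assumes "0 < a" "0 < \<epsilon>"
  shows "eventually (\<lambda>x. pair_tail m (a * x) \<le> \<epsilon> * tail G x) at_top"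
proof -
  let ?B = "\<lambda>i y. {\<omega>\<in>space M. y < Y i \<omega>}"
  \<comment> \<open>There are at most \<open>m * m\<close> pairs; the added 1 keeps the divisor
    positive for \<open>m = 0\<close>.\<close>
  define \<delta> where "\<delta> = \<epsilon> / (real m * real m + 1)"
  have \<delta>: "0 < \<delta>" using assms by (auto simp: \<delta>_def intro!: divide_pos_pos add_nonneg_pos)
  have "eventually (\<lambda>x. \<forall>i\<in>{..<m}. \<forall>j\<in>{..<i}. prob (?B i (a * x) \<inter> ?B j (a * x)) \<le> \<delta> * tail G x) at_top"
  proof (intro eventually_ball_finite ballI finite_lessThan)
    fix i j :: nat assume "j \<in> {..<i}"
    then have "i \<noteq> j" by auto
    from joint_tail_negligible[OF this _ \<delta>, of "a / \<kappa>"]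
    have "eventually (\<lambda>x. prob ({\<omega>\<in>space M. a / \<kappa> * x < Z i \<omega>} \<inter> {\<omega>\<in>space M. a / \<kappa> * x < Z j \<omega>})
        \<le> \<delta> * tail G x) at_top"
      using assms kappa_ge_1 by simp
    then show "eventually (\<lambda>x. prob (?B i (a * x) \<inter> ?B j (a * x)) \<le> \<delta> * tail G x) at_top"
    proof eventually_elim
      case (elim x)
      have "prob (?B i (a * x) \<inter> ?B j (a * x)) \<le>
          prob ({\<omega>\<in>space M. a / \<kappa> * x < Z i \<omega>} \<inter> {\<omega>\<in>space M. a / \<kappa> * x < Z j \<omega>})"
      proof (rule finite_measure_mono_AE)
        show "AE \<omega> in M. \<omega> \<in> ?B i (a * x) \<inter> ?B j (a * x) \<longrightarrow>
          \<omega> \<in> {\<omega>\<in>space M. a / \<kappa> * x < Z i \<omega>} \<inter> {\<omega>\<in>space M. a / \<kappa> * x < Z j \<omega>}"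
          using c_bound[of i] c_bound[of j]
        proof eventually_elim
          case (elim \<omega>)
          have "a / \<kappa> * x < Z k \<omega>" if "\<omega> \<in> space M" "a * x < Y k \<omega>" "c k \<omega> \<le> \<kappa>" for k
          proof -
            have "c k \<omega> * Z k \<omega> \<le> \<kappa> * Z k \<omega>"
              using that Z_nonneg by (intro mult_right_mono) auto
            then show ?thesis using that kappa_ge_1 by (simp add: Y_def field_simps)
          qed
          then show ?case using elim by auto
        qed
      qed measurable
      with elim show ?case by linarith
    qed
  qed
  then show ?thesis
    using eventually_ge_at_top[of 0]
  proof eventually_elim
    case (elim x)
    have "pair_tail m (a * x) \<le> (\<Sum>i<m. \<Sum>j<i. \<delta> * tail G x)"
      unfolding pair_tail_def using elim by (intro sum_mono) auto
    also have "\<dots> \<le> (\<Sum>i<m. \<Sum>j<m. \<delta> * tail G x)"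
      using \<delta> tail_nonneg[OF G_prob] by (intro sum_mono sum_mono2) auto
    also have "\<dots> = (real m * real m) * \<delta> * tail G x" by simp
    also have "\<dots> \<le> \<epsilon> * tail G x"
    proof (intro mult_right_mono tail_nonneg[OF G_prob])
      have "\<epsilon> * (real m * real m) \<le> \<epsilon> * (real m * real m + 1)"
        using assms by (intro mult_left_mono) auto
      moreover have "0 < real m * real m + 1" by (intro add_nonneg_pos) auto
      ultimately show "(real m * real m) * \<delta> \<le> \<epsilon>"
        by (simp add: \<delta>_def pos_divide_le_eq mult.commute)
    qed
    finally show ?case .
  qed
qed

text \<open>A sum above \<open>x\<close> has either one term above \<open>b * x\<close>, where
  consistent variation costs a factor \<open>1 + \<epsilon>\<close>, or two terms above a fixed
  fraction of \<open>x\<close>, which is negligible.\<close>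

lemma finite_sum_upper:
  assumes "0 < \<epsilon>"
  shows "eventually (\<lambda>x. prob {\<omega>\<in>space M. x < (\<Sum>i<m. Y i \<omega>)}
    \<le> (1 + \<epsilon>) * (\<Sum>i. Y_tail i x) + \<epsilon> * tail G x) at_top"
proof -
  obtain b where b: "0 < b" "b < 1"
    and "eventually (\<lambda>x. tail G (b * x) \<le> (1 + \<epsilon>) * tail G x) at_top"
    by (rule consistently_varying_ratio[OF G_consistent assms])
  then obtain y0 where "\<And>y. y0 \<le> y \<Longrightarrow> tail G (b * y) \<le> (1 + \<epsilon>) * tail G y"
    unfolding eventually_at_top_linorder by blast
  then have y0: "tail G (b * y) \<le> (1 + \<epsilon>) * tail G y" if "max 0 y0 \<le> y" for y
    using that by simp
  \<comment> \<open>Dividing by \<open>m + 1\<close> instead of \<open>m\<close> gives a smaller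
    threshold that is positive for every \<open>m\<close> and can be chosen before
    \<open>m > 0\<close> is known.\<close>
  define a where "a = (1 - b) / (real m + 1)"
  have a: "0 < a" using b by (simp add: a_def)
  let ?B = "\<lambda>i y. {\<omega>\<in>space M. y < Y i \<omega>}"
  show ?thesis
    using pair_tail_negligible[OF a assms, of m] eventually_gt_at_top[of 0]
      eventually_ge_at_top[of "max 0 y0 * \<kappa>"]
  proof eventually_elim
    case (elim x)
    have "{\<omega>\<in>space M. x < (\<Sum>i<m. Y i \<omega>)} \<subseteq>
        (\<Union>i<m. ?B i (b * x)) \<union> (\<Union>i<m. \<Union>j<i. ?B i (a * x) \<inter> ?B j (a * x))" (is "_ \<subseteq> ?U \<union> ?V")
    proof
      fix \<omega> assume "\<omega> \<in> {\<omega>\<in>space M. x < (\<Sum>i<m. Y i \<omega>)}"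
      then have \<omega>: "\<omega> \<in> space M" "x < (\<Sum>i<m. Y i \<omega>)" by auto
      have "0 < m" using \<omega>(2) elim by (cases m) auto
      then have le: "a * x \<le> (1 - b) * x / m"
        using elim(2) b by (simp add: a_def frac_le)
      from sum_gt_one_big_or_two_large[OF \<omega>(2) elim(2) b]
      show "\<omega> \<in> ?U \<union> ?V"
      proof (elim disjE exE conjE)
        fix i assume "i < m" "b * x < Y i \<omega>"
        then show ?thesis using \<omega>(1) by blast
      next
        fix i j assume "i < m" "j < i" "(1 - b) * x / m < Y i \<omega>" "(1 - b) * x / m < Y j \<omega>"
        then have "i < m" "j < i" "a * x < Y i \<omega>" "a * x < Y j \<omega>" using le by linarith+
        then show ?thesis using \<omega>(1) by blast
      qed
    qed
    then have "prob {\<omega>\<in>space M. x < (\<Sum>i<m. Y i \<omega>)} \<le> prob (?U \<union> ?V)"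
      by (intro finite_measure_mono) measurable
    also have "\<dots> \<le> prob ?U + prob ?V"
      by (intro measure_Un_le) measurable
    also have "prob ?U \<le> (\<Sum>i<m. Y_tail i (b * x))"
      unfolding Y_tail_def by (intro finite_measure_subadditive_finite) auto
    also have "(\<Sum>i<m. Y_tail i (b * x)) \<le> (\<Sum>i<m. (1 + \<epsilon>) * Y_tail i x)"
      using y0 assms b elim by (intro sum_mono Y_tail_shrink[of "max 0 y0"]) auto
    also have "\<dots> \<le> (1 + \<epsilon>) * (\<Sum>i. Y_tail i x)"
      unfolding sum_distrib_left[symmetric] using assms elim
      by (intro mult_left_mono sum_le_suminf summable_Y_tail) (auto simp: Y_tail_def)
    also have "prob ?V \<le> (\<Sum>i<m. prob (\<Union>j<i. ?B i (a * x) \<inter> ?B j (a * x)))"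
      by (intro finite_measure_subadditive_finite) auto
    also have "\<dots> \<le> pair_tail m (a * x)"
      unfolding pair_tail_def by (intro sum_mono finite_measure_subadditive_finite) auto
    also have "\<dots> \<le> \<epsilon> * tail G x" by (rule elim)
    finally show ?case by simp
  qed
qed

lemma finite_max_lower:
  assumes "0 < \<epsilon>"
  shows "eventually (\<lambda>x. (\<Sum>i<m. Y_tail i x) - \<epsilon> * tail G x
    \<le> prob (\<Union>i<m. {\<omega>\<in>space M. x < Y i \<omega>})) at_top"
  using pair_tail_negligible[OF zero_less_one assms, of m]
proof eventually_elim
  case (elim x)
  have "(\<Sum>i<m. Y_tail i x) \<le> prob (\<Union>i<m. {\<omega>\<in>space M. x < Y i \<omega>}) + pair_tail m x"
    unfolding Y_tail_def pair_tail_def by (rule Bonferroni_lower) measurable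
  with elim show ?case by simp
qed

text \<open>By the Potter bound, \<open>n\<close> claims cost only a factor polynomial in \<open>n\<close>,
  which the moments of the number of claims absorb.\<close>

lemma many_claims_negligible:
  assumes "0 < \<epsilon>"
  obtains m where "\<And>x. 0 < x \<Longrightarrow>
    prob (\<Union>n\<in>{m..}. \<Union>i\<le>n. E n \<inter> {\<omega>\<in>space M. x / (real (Suc n) * \<kappa>) < Z i \<omega>}) \<le> \<epsilon> * tail G x"
proof -
  obtain C p where C: "0 < C"
    "\<And>x y. 0 \<le> x \<Longrightarrow> 1 \<le> y \<Longrightarrow> tail G (x / y) \<le> C * y ^ p * tail G x"
    using tail_Potter_bound[OF G_consistent] by blast
  \<comment> \<open>One power of \<open>n + 1\<close> comes from the union over the claims
    \<open>0..n\<close>, the other \<open>p\<close> from the Potter bound at scale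
    \<open>(n + 1) * \<kappa>\<close>.\<close>
  define s where "s = (\<lambda>n. C * \<kappa> ^ p * (real (Suc n) ^ Suc p * prob (E n)))"
  have s: "summable s" unfolding s_def by (intro summable_mult E_moments)
  then obtain m where m: "norm (\<Sum>k. s (k + m)) < \<epsilon>"
    using suminf_exist_split[OF assms s] by (meson order_refl)
  have "prob (\<Union>n\<in>{m..}. \<Union>i\<le>n. E n \<inter> {\<omega>\<in>space M. x / (real (Suc n) * \<kappa>) < Z i \<omega>}) \<le> \<epsilon> * tail G x"
    if x: "0 < x" for x
  proof -
    let ?H = "\<lambda>n i. E n \<inter> {\<omega>\<in>space M. x / (real (Suc n) * \<kappa>) < Z i \<omega>}"
    have H: "prob (\<Union>i\<le>n. ?H n i) \<le> s n * tail G x" for n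
    proof -
      have "prob (\<Union>i\<le>n. ?H n i) \<le> (\<Sum>i\<le>n. prob (?H n i))"
        by (intro finite_measure_subadditive_finite) auto
      also have "\<dots> = real (Suc n) * (prob (E n) * tail G (x / (real (Suc n) * \<kappa>)))"
        by (simp add: E_Z_indep)
      also have "\<dots> \<le> real (Suc n) * (prob (E n) * (C * (real (Suc n) * \<kappa>) ^ p * tail G x))"
        using x kappa_ge_1 mult_mono[of 1 "real (Suc n)" 1 \<kappa>]
        by (intro mult_left_mono C(2)) auto
      also have "\<dots> = s n * tail G x" by (simp add: s_def power_mult_distrib mult_ac)
      finally show ?thesis .
    qed
    have sum: "summable (\<lambda>k. s (k + m) * tail G x)"
      by (intro summable_mult2 summable_ignore_initial_segment s)
    have summ: "summable (\<lambda>k. prob (\<Union>i\<le>k+m. ?H (k+m) i))"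
      by (rule summable_comparison_test'[OF sum, of 0])
        (simp only: real_norm_def abs_of_nonneg[OF measure_nonneg] H)
    have "(\<Union>n\<in>{m..}. \<Union>i\<le>n. ?H n i) = (\<Union>k. \<Union>i\<le>k+m. ?H (k+m) i)"
    proof -
      have "{m..} = range (\<lambda>k. k + m)"
      proof (intro equalityI subsetI)
        fix n assume "n \<in> {m..}"
        then have "n = (n - m) + m" by simp
        then show "n \<in> range (\<lambda>k. k + m)" by (rule range_eqI)
      qed auto
      then show ?thesis by (simp only: image_image)
    qed
    then have "prob (\<Union>n\<in>{m..}. \<Union>i\<le>n. ?H n i) \<le> (\<Sum>k. prob (\<Union>i\<le>k+m. ?H (k+m) i))"
      using summ by (simp only:) (intro finite_measure_subadditive_countably, auto)
    also have "\<dots> \<le> (\<Sum>k. s (k + m) * tail G x)"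
      by (intro suminf_le summ sum H)
    also have "\<dots> = (\<Sum>k. s (k + m)) * tail G x"
      by (intro suminf_mult2[symmetric] summable_ignore_initial_segment s)
    also have "\<dots> \<le> \<epsilon> * tail G x"
      using m tail_nonneg[OF G_prob] by (intro mult_right_mono) auto
    finally show ?thesis .
  qed
  then show thesis by (rule that)
qed

text \<open>\<open>D x\<close> is squeezed between the maximum and the sum of the weighted claims.
  In \<open>upper\<close>, the index \<open>n\<close> with \<open>\<omega> \<notin> E n\<close>
  certifies that finitely many claims occur, so the finite sum up to \<open>n\<close> contains all
  of them.\<close>

lemma one_big_jump:
  assumes D: "\<And>x. 0 < x \<Longrightarrow> D x \<in> events"
    and lower: "\<And>x i. 0 < x \<Longrightarrow> AE \<omega> in M. x < Y i \<omega> \<longrightarrow> \<omega> \<in> D x"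
    and upper: "\<And>x \<omega>. 0 < x \<Longrightarrow> \<omega> \<in> D x \<Longrightarrow> \<exists>n. \<omega> \<notin> E n \<and> x < (\<Sum>i<n. Y i \<omega>)"
  shows "((\<lambda>x. prob (D x) / (\<Sum>i. Y_tail i x)) \<longlongrightarrow> 1) at_top"
proof -
  have L: "eventually (\<lambda>x. (\<Sum>i. Y_tail i x) - \<epsilon> * tail G x \<le> prob (D x)) at_top"
    if \<epsilon>: "0 < \<epsilon>" for \<epsilon>
  proof -
    obtain C where C: "0 < C" "\<And>i x. 0 < x \<Longrightarrow> Y_tail i x \<le> C * prob (E i) * tail G x"
      using Y_tail_bounds by blast
    have "0 < \<epsilon> / (2 * C)" using \<epsilon> C by simp
    \<comment> \<open>The terms from \<open>m\<close> on contribute at most half of \<epsilon>; the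
      other half pays for the pairs among the first \<open>m\<close>.\<close>
    then obtain m where m: "norm (\<Sum>k. prob (E (k + m))) < \<epsilon> / (2 * C)"
      using suminf_exist_split[OF _ summable_E] by (meson order_refl)
    have "0 < \<epsilon> / 2" using \<epsilon> by simp
    from finite_max_lower[OF this, of m] eventually_gt_at_top[of 0]
    show ?thesis
    proof eventually_elim
      case (elim x)
      have "(\<Sum>i. Y_tail i x) = (\<Sum>k. Y_tail (k + m) x) + (\<Sum>i<m. Y_tail i x)"
        by (rule suminf_split_initial_segment[OF summable_Y_tail[OF elim(2)]])
      also have "(\<Sum>k. Y_tail (k + m) x) \<le> (\<Sum>k. C * prob (E (k + m)) * tail G x)"
        using elim C(2)
        by (intro suminf_le summable_mult summable_mult2 summable_ignore_initial_segment
            summable_E summable_Y_tail) auto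
      also have "\<dots> = C * (\<Sum>k. prob (E (k + m))) * tail G x"
      proof -
        have E: "summable (\<lambda>k. prob (E (k + m)))"
          by (intro summable_ignore_initial_segment summable_E)
        show ?thesis
          unfolding suminf_mult[OF E, symmetric] by (rule suminf_mult2[OF summable_mult[OF E], symmetric])
      qed
      also have "\<dots> \<le> (\<epsilon> / 2) * tail G x"
      proof (intro mult_right_mono tail_nonneg[OF G_prob])
        have "(\<Sum>k. prob (E (k + m))) < \<epsilon> / (2 * C)"
          using m by (simp only: real_norm_def abs_less_iff)
        then show "C * (\<Sum>k. prob (E (k + m))) \<le> \<epsilon> / 2" using C(1) by (simp add: field_simps)
      qed
      finally have 1: "(\<Sum>i. Y_tail i x) \<le> \<epsilon> / 2 * tail G x + (\<Sum>i<m. Y_tail i x)" by simp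
      have "prob (\<Union>i<m. {\<omega>\<in>space M. x < Y i \<omega>}) \<le> prob (D x)"
      proof (rule finite_measure_mono_AE)
        have "AE \<omega> in M. \<forall>i. x < Y i \<omega> \<longrightarrow> \<omega> \<in> D x"
          unfolding AE_all_countable by (intro allI lower[OF elim(2)])
        then show "AE \<omega> in M. \<omega> \<in> (\<Union>i<m. {\<omega>\<in>space M. x < Y i \<omega>}) \<longrightarrow> \<omega> \<in> D x"
          by eventually_elim auto
      qed (rule D[OF elim(2)])
      with 1 elim(1) show ?case by (simp add: algebra_simps)
    qed
  qed
  have U: "eventually (\<lambda>x. prob (D x) \<le> (1 + \<epsilon>) * (\<Sum>i. Y_tail i x) + 2 * \<epsilon> * tail G x) at_top"
    if \<epsilon>: "0 < \<epsilon>" for \<epsilon>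
  proof -
    obtain m where m: "\<And>x. 0 < x \<Longrightarrow>
        prob (\<Union>n\<in>{m..}. \<Union>i\<le>n. E n \<inter> {\<omega>\<in>space M. x / (real (Suc n) * \<kappa>) < Z i \<omega>}) \<le> \<epsilon> * tail G x"
      using many_claims_negligible[OF \<epsilon>] by blast
    show ?thesis
      using finite_sum_upper[OF \<epsilon>, of m] eventually_gt_at_top[of 0]
    proof eventually_elim
      case (elim x)
      let ?S = "{\<omega>\<in>space M. x < (\<Sum>i<m. Y i \<omega>)}"
      let ?V = "\<Union>n\<in>{m..}. \<Union>i\<le>n. E n \<inter> {\<omega>\<in>space M. x / (real (Suc n) * \<kappa>) < Z i \<omega>}"
      have "AE \<omega> in M. \<forall>i. c i \<omega> \<le> \<kappa>"
        unfolding AE_all_countable by (intro allI c_bound)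
      then have "AE \<omega> in M. \<omega> \<in> D x \<longrightarrow> \<omega> \<in> ?S \<union> ?V"
      proof (eventually_elim, intro impI)
        fix \<omega> assume c: "\<forall>i. c i \<omega> \<le> \<kappa>" and \<omega>: "\<omega> \<in> D x"
        have sp: "\<omega> \<in> space M" using \<omega> D[OF elim(2)] sets.sets_into_space by blast
        obtain n0 where n0: "\<omega> \<notin> E n0" "x < (\<Sum>i<n0. Y i \<omega>)" using upper[OF elim(2) \<omega>] by blast
        \<comment> \<open>Since the \<open>E k\<close> decrease, this \<open>n\<close> is the exact
          number of claims: \<omega> is in \<open>E k\<close> for \<open>k < n\<close> and in none
          from \<open>n\<close> on.\<close>
        define n where "n = (LEAST n. \<omega> \<notin> E n)"
        have n: "\<omega> \<notin> E n" unfolding n_def by (rule LeastI) (rule n0)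
        have before: "\<omega> \<in> E k" if "k < n" for k using not_less_Least[of k] that by (auto simp: n_def)
        have after: "Y k \<omega> = 0" if "n \<le> k" for k
          using n E_mono[OF that] c_zero[OF sp, of k] by (auto simp: Y_def)
        have "(\<Sum>i<k. Y i \<omega>) \<le> (\<Sum>i<n. Y i \<omega>)" for k
        proof -
          have "(\<Sum>i<k. Y i \<omega>) \<le> (\<Sum>i\<in>{..<max k n}. Y i \<omega>)"
            using Y_nonneg[OF sp] by (intro sum_mono2) auto
          also have "\<dots> = (\<Sum>i<n. Y i \<omega>)"
            using after by (intro sum.mono_neutral_right) auto
          finally show ?thesis .
        qed
        with n0(2) have xn: "x < (\<Sum>i<n. Y i \<omega>)" by (rule less_le_trans)
        show "\<omega> \<in> ?S \<union> ?V"
        proof (cases "n \<le> m")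
          case True
          have "(\<Sum>i<n. Y i \<omega>) \<le> (\<Sum>i<m. Y i \<omega>)"
            using True Y_nonneg[OF sp] by (intro sum_mono2) auto
          with xn sp show ?thesis by simp
        next
          case False
          then obtain k where k: "n = Suc k" "m \<le> k" by (cases n) auto
          \<comment> \<open>If \<open>n\<close> terms have a sum above \<open>x\<close>, one of them
            exceeds \<open>x / n\<close>. With \<open>n = Suc k\<close> this places \<omega> in the
            union at index \<open>k \<ge> m\<close>.\<close>
          have "\<exists>i<n. x / n < Y i \<omega>"
          proof (rule ccontr)
            assume "\<not> ?thesis"
            then have "Y i \<omega> \<le> x / n" if "i < n" for i using that not_less by blast
            then have "(\<Sum>i<n. Y i \<omega>) \<le> card {..<n} * (x / n)"
              by (intro sum_bounded_above) simp
            with xn k show False by simp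
          qed
          then obtain i where i: "i < n" "x / n < Y i \<omega>" by blast
          have "c i \<omega> * Z i \<omega> \<le> \<kappa> * Z i \<omega>"
            using c Z_nonneg[OF sp] by (intro mult_right_mono) auto
          with i have "x / n < Z i \<omega> * \<kappa>" by (simp add: Y_def mult.commute)
          then have "x / n / \<kappa> < Z i \<omega>" using kappa_ge_1 by (subst pos_divide_less_eq) auto
          then have "x / (real (Suc k) * \<kappa>) < Z i \<omega>" by (simp add: k)
          then have "\<omega> \<in> E k \<inter> {\<omega>\<in>space M. x / (real (Suc k) * \<kappa>) < Z i \<omega>}"
            using before[of k] k sp by simp
          moreover have "i \<le> k" using i k by simp
          ultimately show ?thesis using k(2) by blast
        qed
      qed
      then have "prob (D x) \<le> prob (?S \<union> ?V)"
        by (rule finite_measure_mono_AE) measurable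
      also have "\<dots> \<le> prob ?S + prob ?V"
        by (intro measure_Un_le) measurable
      finally show ?case using elim(1) m[OF elim(2)] by simp
    qed
  qed
  obtain C where C: "0 < C" "\<And>x. 0 < x \<Longrightarrow> tail G x \<le> C * (\<Sum>i. Y_tail i x)"
    using Y_tail_lower by blast
  show ?thesis
  proof (rule tendstoI)
    fix e :: real assume e: "0 < e"
    \<comment> \<open>The total deviation is at most
      \<open>\<epsilon> * ?R + 2 * \<epsilon> * tail G x\<close>, hence at most
      \<open>\<epsilon> * (1 + 2 * C) * ?R\<close>, which is half of \<open>e * ?R\<close>.\<close>
    define \<epsilon> where "\<epsilon> = e / (2 * (1 + 2 * C))"
    have \<epsilon>: "0 < \<epsilon>" "\<epsilon> * (1 + 2 * C) < e"
      using e C(1) by (auto simp: \<epsilon>_def divide_simps add_pos_pos)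
    show "eventually (\<lambda>x. dist (prob (D x) / (\<Sum>i. Y_tail i x)) 1 < e) at_top"
      using L[OF \<epsilon>(1)] U[OF \<epsilon>(1)] eventually_gt_at_top[of 0]
    proof eventually_elim
      case (elim x)
      let ?R = "\<Sum>i. Y_tail i x"
      have t: "tail G x \<le> C * ?R" "0 < tail G x" using C(2) tail_pos elim by auto
      then have "0 < C * ?R" by linarith
      then have R: "0 < ?R" using C(1) by (simp add: zero_less_mult_iff)
      have "\<epsilon> * tail G x \<le> \<epsilon> * (C * ?R)" using \<epsilon> t by (intro mult_left_mono) auto
      then have "\<bar>prob (D x) - ?R\<bar> \<le> (\<epsilon> * (1 + 2 * C)) * ?R"
      proof -
        have "(\<epsilon> * (1 + 2 * C)) * ?R = \<epsilon> * ?R + 2 * (\<epsilon> * (C * ?R))" by (simp add: algebra_simps)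
        moreover have "0 \<le> \<epsilon> * ?R" "0 \<le> \<epsilon> * (C * ?R)" using \<epsilon>(1) R C(1) by simp_all
        moreover have "(1 + \<epsilon>) * ?R = ?R + \<epsilon> * ?R" by (simp add: algebra_simps)
        ultimately show ?thesis
          using elim \<open>\<epsilon> * tail G x \<le> \<epsilon> * (C * ?R)\<close> unfolding abs_le_iff by linarith
      qed
      also have "\<dots> < e * ?R" using \<epsilon> R by (intro mult_strict_right_mono)
      finally have "\<bar>prob (D x) - ?R\<bar> / ?R < e" using R by (simp add: pos_divide_less_eq)
      moreover have "prob (D x) / ?R - 1 = (prob (D x) - ?R) / ?R" using R by (simp add: field_simps)
      ultimately show ?case using R by (simp add: dist_real_def)
    qed
  qed
qed

end

subsection \<open>Independence and measurability\<close>

lemma (in prob_space) measurable_indep_subalgebras: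
  assumes "indep_set (sets N1) (sets N2)" "space N1 = space M" "space N2 = space M"
    and U: "U \<in> measurable N1 S" and V: "V \<in> measurable N2 S'"
  shows "U \<in> measurable M S" "V \<in> measurable M S'"
  by (rule measurable_from_subalg[OF _ U] measurable_from_subalg[OF _ V],
      simp add: subalgebra_def assms indep_setD_ev1[OF assms(1)] indep_setD_ev2[OF assms(1)])+

text \<open>The target spaces are arbitrary, so that \<open>V\<close> may later be the identity into
  a coarser sigma-algebra: a whole path of \<xi> then enters as one random element.\<close>

lemma (in prob_space) distr_pair_of_indep_subalgebras:
  assumes "indep_set (sets N1) (sets N2)" "space N1 = space M" "space N2 = space M"
    and U: "U \<in> measurable N1 S" and V: "V \<in> measurable N2 S'"
  shows "distr M S U \<Otimes>\<^sub>M distr M S' V = distr M (S \<Otimes>\<^sub>M S') (\<lambda>\<omega>. (U \<omega>, V \<omega>))"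
proof (rule pair_measure_eqI)
  note meas [measurable] = measurable_indep_subalgebras[OF assms]
  interpret U: prob_space "distr M S U" by (rule prob_space_distr[OF meas(1)])
  interpret V: prob_space "distr M S' V" by (rule prob_space_distr[OF meas(2)])
  show "sigma_finite_measure (distr M S U)" "sigma_finite_measure (distr M S' V)"
    by unfold_locales
  show "sets (distr M S U \<Otimes>\<^sub>M distr M S' V) = sets (distr M (S \<Otimes>\<^sub>M S') (\<lambda>\<omega>. (U \<omega>, V \<omega>)))"
    unfolding sets_distr by (rule sets_pair_measure_cong) simp_all
  fix B C assume "B \<in> sets (distr M S U)" "C \<in> sets (distr M S' V)"
  then have B: "B \<in> sets S" and C: "C \<in> sets S'" by simp_all
  have "prob ((U -` B \<inter> space M) \<inter> (V -` C \<inter> space M)) =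
      prob (U -` B \<inter> space M) * prob (V -` C \<inter> space M)"
    using measurable_sets[OF U B] measurable_sets[OF V C] assms(2,3)
    by (intro indep_setD[OF assms(1)]) simp_all
  moreover have "(\<lambda>\<omega>. (U \<omega>, V \<omega>)) -` (B \<times> C) \<inter> space M = (U -` B \<inter> space M) \<inter> (V -` C \<inter> space M)"
    by auto
  ultimately show "emeasure (distr M S U) B * emeasure (distr M S' V) C =
      emeasure (distr M (S \<Otimes>\<^sub>M S') (\<lambda>\<omega>. (U \<omega>, V \<omega>))) (B \<times> C)"
    using B C by (simp add: emeasure_distr emeasure_eq_measure ennreal_mult)
qed

lemma (in prob_space) indep_var_of_indep_subalgebras:
  assumes "indep_set (sets N1) (sets N2)" "space N1 = space M" "space N2 = space M"
    and U: "U \<in> measurable N1 S" and V: "V \<in> measurable N2 S'"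
  shows "indep_var S U S' V"
  unfolding indep_var_distribution_eq
  using measurable_indep_subalgebras[OF assms] distr_pair_of_indep_subalgebras[OF assms] by simp

text \<open>Time is rounded up to the grid point \<open>u n t\<close>, strictly to the right of
  \<open>t\<close> and within \<open>1 / (n + 1)\<close> of it. The approximations take countably
  many time values, hence are measurable, and converge by right-continuity. The \<open>max 0\<close>
  extends the process to negative times.\<close>

lemma right_continuous_jointly_measurable:
  fixes f :: "real \<Rightarrow> 'a \<Rightarrow> real"
  assumes f: "\<And>t. 0 \<le> t \<Longrightarrow> f t \<in> borel_measurable N"
    and rc: "\<And>\<omega> t. \<omega> \<in> space N \<Longrightarrow> 0 \<le> t \<Longrightarrow> ((\<lambda>s. f s \<omega>) \<longlongrightarrow> f t \<omega>) (at_right t)"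
  shows "(\<lambda>p. f (max 0 (fst p)) (snd p)) \<in> borel_measurable (borel \<Otimes>\<^sub>M N)"
proof -
  define u :: "nat \<Rightarrow> real \<Rightarrow> real"
    where "u n t = (real (nat \<lfloor>t * real (Suc n)\<rfloor>) + 1) / real (Suc n)" for n t
  have u: "t < u n t \<and> u n t \<le> t + 1 / real (Suc n)" if "0 \<le> t" for n t
  proof -
    define k where "k = real (nat \<lfloor>t * real (Suc n)\<rfloor>)"
    have "k = of_int \<lfloor>t * real (Suc n)\<rfloor>"
      unfolding k_def using that by (intro of_nat_nat) simp
    then have "t * real (Suc n) < k + 1" "k \<le> t * real (Suc n)" by linarith+
    then have "t < (k + 1) / real (Suc n)" "k / real (Suc n) \<le> t"
      by (simp_all only: pos_less_divide_eq pos_divide_le_eq of_nat_0_less_iff zero_less_Suc)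
    then show ?thesis unfolding u_def k_def[symmetric] add_divide_distrib by linarith
  qed
  show ?thesis
  proof (rule borel_measurable_LIMSEQ_real)
    fix p :: "real \<times> 'a" assume p: "p \<in> space (borel \<Otimes>\<^sub>M N)"
    define t where "t = max 0 (fst p)"
    have t: "0 \<le> t" by (simp add: t_def)
    have "(\<lambda>n. t + 1 / real (Suc n)) \<longlonglongrightarrow> t + 0"
      by (intro tendsto_add tendsto_const LIMSEQ_Suc[OF lim_1_over_n])
    then have upper: "(\<lambda>n. t + 1 / real (Suc n)) \<longlonglongrightarrow> t" by simp
    have "(\<lambda>n. u n t) \<longlonglongrightarrow> t"
    proof (rule tendsto_sandwich[OF _ _ tendsto_const upper])
      show "eventually (\<lambda>n. t \<le> u n t) sequentially"
        using u[OF t] by (simp add: less_imp_le)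
      show "eventually (\<lambda>n. u n t \<le> t + 1 / real (Suc n)) sequentially"
        using u[OF t] by simp
    qed
    then have "filterlim (\<lambda>n. u n t) (at_right t) sequentially"
      using u[OF t] by (simp add: filterlim_at less_imp_neq[symmetric])
    moreover have "snd p \<in> space N" using p by (auto simp: space_pair_measure)
    ultimately show "(\<lambda>n. f (u n (max 0 (fst p))) (snd p)) \<longlonglongrightarrow> f (max 0 (fst p)) (snd p)"
      unfolding t_def[symmetric] by (rule filterlim_compose[OF rc[OF _ t], rotated])
  next
    fix n
    have "(\<lambda>p. f ((real k + 1) / real (Suc n)) (snd p)) \<in> borel_measurable (borel \<Otimes>\<^sub>M N)" for k
      by (rule measurable_compose[OF measurable_snd f]) simp
    moreover have "(\<lambda>p. nat \<lfloor>max 0 (fst p) * real (Suc n)\<rfloor>)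
        \<in> measurable (borel \<Otimes>\<^sub>M N) (count_space UNIV)"
      by measurable
    ultimately show "(\<lambda>p. f (u n (max 0 (fst p))) (snd p)) \<in> borel_measurable (borel \<Otimes>\<^sub>M N)"
      unfolding u_def by (rule measurable_compose_countable)
  qed
qed

lemma sets_sigma_process_sigma:
  "sets (sigma (space M) (process_sigma M S I W)) = process_sigma M S I W"
  "space (sigma (space M) (process_sigma M S I W)) = space M"
proof -
  have "process_sigma M S I W \<subseteq> Pow (space M)"
    unfolding process_sigma_def
    by (intro subsetI PowI sigma_sets_into_sp[where A="\<Union>i\<in>I. {W i -` B \<inter> space M | B. B \<in> sets S}"])
      auto
  then show "sets (sigma (space M) (process_sigma M S I W)) = process_sigma M S I W"
    unfolding process_sigma_def
    by (subst sets_measure_of) (auto intro!: sigma_sets_sigma_sets_eq)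
qed (simp add: space_measure_of_conv)

lemma measurable_process_sigma:
  assumes "i \<in> I" "W i \<in> space M \<rightarrow> space S"
  shows "W i \<in> measurable (sigma (space M) (process_sigma M S I W)) S"
proof (rule measurableI)
  fix B assume "B \<in> sets S"
  then show "W i -` B \<inter> space (sigma (space M) (process_sigma M S I W))
      \<in> sets (sigma (space M) (process_sigma M S I W))"
    unfolding sets_sigma_process_sigma unfolding process_sigma_def using assms by (auto intro!: sigma_sets.Basic)
qed (use assms in \<open>auto simp: sets_sigma_process_sigma\<close>)

subsection \<open>Renewal processes\<close>

context renewal_risk_model
begin

lemma arrival_time_nonneg: "\<omega> \<in> space M \<Longrightarrow> 0 \<le> arrival_time \<theta> i \<omega>"
  unfolding arrival_time_def by (intro sum_nonneg interarrival_nonneg) auto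

lemma arrival_time_mono:
  assumes "\<omega> \<in> space M" "i \<le> j"
  shows "arrival_time \<theta> i \<omega> \<le> arrival_time \<theta> j \<omega>"
  unfolding arrival_time_def using assms interarrival_nonneg by (intro sum_mono2) auto

text \<open>Arrival times are monotone, so the indices arrived by \<open>t\<close> form an initial
  segment, possibly with ties. The restriction \<open>1 \<le> i\<close> matches the value 0 of the
  empty supremum.\<close>

lemma le_counting_iff:
  assumes "\<omega> \<in> space M" "1 \<le> i"
  shows "enat i \<le> counting \<theta> t \<omega> \<longleftrightarrow> arrival_time \<theta> i \<omega> \<le> t"
proof
  assume *: "enat i \<le> counting \<theta> t \<omega>"
  show "arrival_time \<theta> i \<omega> \<le> t"
  proof (rule ccontr)
    assume "\<not> arrival_time \<theta> i \<omega> \<le> t"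
    then have "j < i" if "arrival_time \<theta> j \<omega> \<le> t" for j
      using arrival_time_mono[OF assms(1), of i j] that by (cases "j < i") auto
    then have "counting \<theta> t \<omega> \<le> enat (i - 1)"
      unfolding counting_def by (intro SUP_least) fastforce
    with * have "enat i \<le> enat (i - 1)" by (rule order_trans)
    with assms(2) show False by simp
  qed
next
  assume "arrival_time \<theta> i \<omega> \<le> t"
  then show "enat i \<le> counting \<theta> t \<omega>"
    unfolding counting_def using assms by (intro SUP_upper) auto
qed

text \<open>The renewal measure is the image of counting measure times \<open>M\<close> under the
  map sending an index and \<omega> to the arrival time; the formula is then Tonelli.\<close>

lemma nn_integral_renewal_measure:
  assumes f[measurable]: "f \<in> borel_measurable borel"
  shows "(\<integral>\<^sup>+s. f s \<partial>renewal_measure M \<theta>) = (\<Sum>i. \<integral>\<^sup>+\<omega>. f (arrival_time \<theta> (Suc i) \<omega>) \<partial>M)"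
proof -
  note [measurable] = arrival_time_measurable
  interpret C: sigma_finite_measure "count_space (UNIV :: nat set)"
    by (rule sigma_finite_measure_count_space)
  let ?P = "count_space UNIV \<Otimes>\<^sub>M M" and ?g = "\<lambda>p. arrival_time \<theta> (Suc (fst p)) (snd p)"
  have g: "?g \<in> borel_measurable ?P"
    by (rule measurable_compose_countable[of "\<lambda>i p. arrival_time \<theta> (Suc i) (snd p)" _ _ fst]) measurable
  have "renewal_measure M \<theta> = distr ?P borel ?g"
  proof (rule measure_eqI)
    show "sets (renewal_measure M \<theta>) = sets (distr ?P borel ?g)"
      using sets.sigma_sets_eq[of "borel :: real measure"]
      by (simp add: renewal_measure_def sets_measure_of)
    fix B assume "B \<in> sets (renewal_measure M \<theta>)"
    then have B[measurable]: "B \<in> sets borel"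
      using sets.sigma_sets_eq[of "borel :: real measure"]
      by (simp add: renewal_measure_def sets_measure_of)
    have "emeasure (distr ?P borel ?g) B = emeasure ?P (?g -` B \<inter> space ?P)"
      using g B by (rule emeasure_distr)
    also have "\<dots> = (\<integral>\<^sup>+i. emeasure M (Pair i -` (?g -` B \<inter> space ?P)) \<partial>count_space UNIV)"
      using g B by (intro emeasure_pair_measure_alt measurable_sets)
    also have "\<dots> = (\<Sum>i. emeasure M {\<omega>\<in>space M. arrival_time \<theta> (Suc i) \<omega> \<in> B})"
      unfolding nn_integral_count_space_nat
      by (intro suminf_cong arg_cong[where f="emeasure M"]) (auto simp: space_pair_measure)
    finally show "emeasure (renewal_measure M \<theta>) B = emeasure (distr ?P borel ?g) B"
      by (simp add: emeasure_renewal_measure)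
  qed
  then have "(\<integral>\<^sup>+s. f s \<partial>renewal_measure M \<theta>) = (\<integral>\<^sup>+p. f (?g p) \<partial>?P)"
    using g by (simp add: nn_integral_distr)
  also have "\<dots> = (\<integral>\<^sup>+i. \<integral>\<^sup>+\<omega>. f (?g (i, \<omega>)) \<partial>M \<partial>count_space UNIV)"
    using g by (intro nn_integral_fst[symmetric] measurable_compose[OF _ f])
  finally show ?thesis by (simp add: nn_integral_count_space_nat)
qed

text \<open>A Chernoff bound: \<rho> is the Laplace transform of an inter-arrival time at 1. It is
  below 1 because the inter-arrival times are nonnegative and not almost surely 0, and independence
  multiplies it up.\<close>

lemma arrival_time_geometric_tail:
  obtains \<rho> where "0 \<le> \<rho>" "\<rho> < 1"
    "\<And>n. prob {\<omega>\<in>space M. arrival_time \<theta> n \<omega> \<le> T} \<le> exp T * \<rho> ^ n"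
proof -
  have \<theta>_meas: "\<theta> k \<in> borel_measurable M" if "1 \<le> k" for k
    using interarrival_indep that by (auto simp: indep_vars_def)
  define \<rho> where "\<rho> = expectation (\<lambda>\<omega>. exp (- \<theta> 1 \<omega>))"
  have int: "integrable M (\<lambda>\<omega>. exp (- \<theta> k \<omega>))" if "1 \<le> k" for k
    using \<theta>_meas[OF that] interarrival_nonneg[OF that]
    by (intro integrable_const_bound[of _ 1]) auto
  have same: "expectation (\<lambda>\<omega>. exp (- \<theta> k \<omega>)) = \<rho>" if "1 \<le> k" for k
  proof -
    have "expectation (\<lambda>\<omega>. exp (- \<theta> k \<omega>)) = (\<integral>y. exp (- y) \<partial>distr M borel (\<theta> k))" if "1 \<le> k" for k
      using \<theta>_meas[OF that] by (subst integral_distr) auto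
    then show ?thesis using that interarrival_identical[OF that] by (simp add: \<rho>_def)
  qed
  have "0 \<le> \<rho>" unfolding \<rho>_def by (intro integral_nonneg_AE) auto
  moreover have "\<rho> < 1"
  proof (rule ccontr)
    assume "\<not> \<rho> < 1"
    have int': "integrable M (\<lambda>\<omega>. 1 - exp (- \<theta> 1 \<omega>))" using int[of 1] by simp
    have nn: "AE \<omega> in M. 0 \<le> 1 - exp (- \<theta> 1 \<omega>)" using interarrival_nonneg[of 1] by auto
    have "expectation (\<lambda>\<omega>. 1 - exp (- \<theta> 1 \<omega>)) = 1 - \<rho>"
      unfolding \<rho>_def using int[of 1] by (simp add: prob_space)
    moreover have "0 \<le> expectation (\<lambda>\<omega>. 1 - exp (- \<theta> 1 \<omega>))" using nn by (rule integral_nonneg_AE)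
    ultimately have "expectation (\<lambda>\<omega>. 1 - exp (- \<theta> 1 \<omega>)) = 0" using \<open>\<not> \<rho> < 1\<close> by simp
    then have "AE \<omega> in M. 1 - exp (- \<theta> 1 \<omega>) = 0"
      using integral_nonneg_eq_0_iff_AE[OF int' nn] by simp
    then have "AE \<omega> in M. \<theta> 1 \<omega> = 0" by eventually_elim simp
    with interarrival_nonzero show False by simp
  qed
  moreover have "prob {\<omega>\<in>space M. arrival_time \<theta> n \<omega> \<le> T} \<le> exp T * \<rho> ^ n" for n
  proof -
    note [measurable] = arrival_time_measurable
    have prod: "exp (- arrival_time \<theta> n \<omega>) = (\<Prod>k\<in>{1..n}. exp (- \<theta> k \<omega>))" for \<omega>
      by (simp add: arrival_time_def sum_negf[symmetric] exp_sum)
    have ind: "indep_vars (\<lambda>_. borel) (\<lambda>k \<omega>. exp (- \<theta> k \<omega>)) {1..n}"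
      by (rule indep_vars_compose2[OF indep_vars_subset[OF interarrival_indep]]) auto
    have "expectation (\<lambda>\<omega>. exp (- arrival_time \<theta> n \<omega>)) = (\<Prod>k\<in>{1..n}. expectation (\<lambda>\<omega>. exp (- \<theta> k \<omega>)))"
      unfolding prod using ind int by (intro indep_vars_lebesgue_integral) auto
    also have "\<dots> = \<rho> ^ n" using same by simp
    finally have E: "expectation (\<lambda>\<omega>. exp (- arrival_time \<theta> n \<omega>)) = \<rho> ^ n" .
    have "integrable M (\<lambda>\<omega>. exp (- arrival_time \<theta> n \<omega>))"
      unfolding prod using ind int by (intro indep_vars_integrable) auto
    then have "prob {\<omega>\<in>space M. exp (- T) \<le> exp (- arrival_time \<theta> n \<omega>)} \<le> \<rho> ^ n / exp (- T)"
      unfolding E[symmetric] by (intro integral_Markov_inequality_measure[where A="{}"]) auto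
    then show ?thesis by (simp add: exp_minus field_simps)
  qed
  ultimately show thesis by (rule that)
qed

lemma arrival_time_moments:
  "summable (\<lambda>n. real (Suc n) ^ p * prob {\<omega>\<in>space M. arrival_time \<theta> (Suc n) \<omega> \<le> T})"
proof -
  obtain \<rho> where \<rho>: "0 \<le> \<rho>" "\<rho> < 1"
    and le: "\<And>n. prob {\<omega>\<in>space M. arrival_time \<theta> n \<omega> \<le> T} \<le> exp T * \<rho> ^ n"
    using arrival_time_geometric_tail by blast
  \<comment> \<open>\<rho> may be 0, so it is replaced by a positive \<open>r < 1\<close>; the
    further gap between \<open>r\<close> and \<open>q\<close> below absorbs the polynomial
    factor.\<close>
  define r where "r = (1 + \<rho>) / 2"
  have r: "0 < r" "r < 1" "\<rho> < r" using \<rho> by (auto simp: r_def)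
  define q where "q = (r + 1) / 2"
  have q: "0 < q" "q < 1" "r < q" using r by (auto simp: q_def)
  have "summable (\<lambda>n. norm (q ^ n))"
    using q summable_geometric[of q] by simp
  moreover have "(\<lambda>n. real (Suc n) ^ p * r ^ Suc n) \<in> O(\<lambda>n. q ^ n)"
    using r q by real_asymp
  ultimately have "summable (\<lambda>n. real (Suc n) ^ p * r ^ Suc n)"
    by (rule summable_comparison_test_bigo)
  then have "summable (\<lambda>n. exp T * (real (Suc n) ^ p * r ^ Suc n))" by (rule summable_mult)
  then show ?thesis
  proof (rule summable_comparison_test')
    fix n
    have "\<rho> ^ Suc n \<le> r ^ Suc n" using \<rho> r by (intro power_mono) auto
    then have "exp T * \<rho> ^ Suc n \<le> exp T * r ^ Suc n" by (intro mult_left_mono) auto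
    with le[of "Suc n"] have "prob {\<omega>\<in>space M. arrival_time \<theta> (Suc n) \<omega> \<le> T} \<le> exp T * r ^ Suc n"
      by (rule order_trans)
    then have "real (Suc n) ^ p * prob {\<omega>\<in>space M. arrival_time \<theta> (Suc n) \<omega> \<le> T}
        \<le> real (Suc n) ^ p * (exp T * r ^ Suc n)" by (intro mult_left_mono) auto
    then show "norm (real (Suc n) ^ p * prob {\<omega>\<in>space M. arrival_time \<theta> (Suc n) \<omega> \<le> T})
        \<le> exp T * (real (Suc n) ^ p * r ^ Suc n)" by (simp add: abs_mult mult_ac)
  qed
qed

end

subsection \<open>Discounted aggregate claims\<close>

locale heavy_tailed_renewal_model = renewal_risk_model M X F \<theta> \<xi>
  for M :: "'a measure" and X :: "nat \<Rightarrow> 'a \<Rightarrow> real ^ 'n" and F \<theta> \<xi> +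
  fixes A :: "(real ^ 'n) set" and T K :: real
  assumes A: "A \<in> family_R"
    and mutual_indep: "indep_sets
           (\<lambda>k::nat. [process_sigma M borel {1..} X,
                      process_sigma M (count_space UNIV) {0..} (counting \<theta>),
                      process_sigma M borel {0..} \<xi>] ! k) {0, 1, 2}"
    and K_nonneg: "0 \<le> K"
    and xi_bound: "AE \<omega> in M. \<forall>s\<in>{0..T}. - K \<le> \<xi> s \<omega>"
    and X_QAI: "QAI_on A M {1..} X"
    and F_consistent: "consistently_varying_on A F"
    and T_nonneg: "0 \<le> T"
    and renewal_pos: "0 < renewal_function M \<theta> T"
begin

section \<open>The three sigma-algebras and their independence\<close>

definition "claim_algebra = sigma (space M) (process_sigma M borel {1..} X)"
definition "counting_algebra = sigma (space M) (process_sigma M (count_space UNIV) {0..} (counting \<theta>))"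
definition "discount_algebra = sigma (space M) (process_sigma M borel {0..} \<xi>)"
text \<open>A weight depends on the arrival time and on the path of \<xi>, hence on both sources
  jointly.\<close>

definition "weight_algebra = sigma (space M) (sets counting_algebra \<union> sets discount_algebra)"

lemma space_algebras:
  "space claim_algebra = space M" "space counting_algebra = space M"
  "space discount_algebra = space M" "space weight_algebra = space M"
  by (simp_all add: claim_algebra_def counting_algebra_def discount_algebra_def weight_algebra_def
      sets_sigma_process_sigma space_measure_of_conv)

lemma sets_weight_algebra:
  "sets weight_algebra = sigma_sets (space M) (sets counting_algebra \<union> sets discount_algebra)"
  unfolding weight_algebra_def
  using sets.space_closed[of counting_algebra] sets.space_closed[of discount_algebra]
  by (subst sets_measure_of) (simp_all add: space_algebras)

definition algebras :: "nat \<Rightarrow> 'a set set" where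
  "algebras k = [sets claim_algebra, sets counting_algebra, sets discount_algebra] ! k"

lemma algebras_simps [simp]:
  "algebras 0 = sets claim_algebra" "algebras (Suc 0) = sets counting_algebra"
  "algebras 2 = sets discount_algebra"
  by (simp_all add: algebras_def)

lemma indep_algebras: "indep_sets algebras {0, 1, 2}"
  using mutual_indep unfolding algebras_def[abs_def] claim_algebra_def counting_algebra_def
    discount_algebra_def sets_sigma_process_sigma .

lemma Int_stable_algebras: "i \<in> {0, 1, 2} \<Longrightarrow> Int_stable (algebras i)"
  by (auto simp: sets.Int_stable)

text \<open>Mutual independence is grouped as claims against the rest, which separates each
  \<open>Z i\<close> from weights and arrival events. The split into arrivals against discounting
  below serves the denominator.\<close>

lemma indep_claim_weight: "indep_set (sets claim_algebra) (sets weight_algebra)"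
proof -
  let ?I = "case_bool {0} {1, 2 :: nat}"
  have "indep_sets (\<lambda>j. sigma_sets (space M) (\<Union>i\<in>?I j. algebras i)) UNIV"
  proof (rule indep_sets_collect_sigma)
    have "(\<Union>j\<in>UNIV. ?I j) = {0, 1, 2}" by (auto simp: UNIV_bool)
    then show "indep_sets algebras (\<Union>j\<in>UNIV. ?I j)" using indep_algebras by simp
    show "Int_stable (algebras i)" if "i \<in> ?I j" for i j
      using that by (intro Int_stable_algebras) (cases j; auto)
    show "disjoint_family_on ?I UNIV" by (auto simp: disjoint_family_on_def split: bool.splits)
  qed
  moreover have "(\<lambda>j. sigma_sets (space M) (\<Union>i\<in>?I j. algebras i)) =
      case_bool (sets claim_algebra) (sets weight_algebra)"
    using sets.sigma_sets_eq[of claim_algebra]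
    by (intro ext) (simp add: sets_weight_algebra space_algebras split: bool.split)
  ultimately show ?thesis unfolding indep_set_def by simp
qed

lemma indep_weight_claim: "indep_set (sets weight_algebra) (sets claim_algebra)"
proof (rule indep_setI)
  fix a b assume "a \<in> sets weight_algebra" "b \<in> sets claim_algebra"
  then show "prob (a \<inter> b) = prob a * prob b"
    using indep_setD[OF indep_claim_weight, of b a] by (simp add: Int_commute mult.commute)
qed (rule indep_setD_ev2[OF indep_claim_weight] indep_setD_ev1[OF indep_claim_weight])+

lemma indep_counting_discount: "indep_set (sets counting_algebra) (sets discount_algebra)"
proof -
  let ?I = "case_bool {1 :: nat} {2}"
  have "indep_sets (\<lambda>j. sigma_sets (space M) (\<Union>i\<in>?I j. algebras i)) UNIV"
  proof (rule indep_sets_collect_sigma)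
    have "(\<Union>j\<in>UNIV. ?I j) = {1, 2}" by (auto simp: UNIV_bool)
    then show "indep_sets algebras (\<Union>j\<in>UNIV. ?I j)"
      using indep_sets_mono_index[OF _ indep_algebras, of "{1, 2}"] by simp
    show "Int_stable (algebras i)" if "i \<in> ?I j" for i j
      using that by (intro Int_stable_algebras) (cases j; auto)
    show "disjoint_family_on ?I UNIV" by (auto simp: disjoint_family_on_def split: bool.splits)
  qed
  moreover have "(\<lambda>j. sigma_sets (space M) (\<Union>i\<in>?I j. algebras i)) =
      case_bool (sets counting_algebra) (sets discount_algebra)"
    using sets.sigma_sets_eq[of counting_algebra] sets.sigma_sets_eq[of discount_algebra]
    by (intro ext) (simp add: space_algebras split: bool.split)
  ultimately show ?thesis unfolding indep_set_def by simp
qed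

lemma subalgebras:
  "subalgebra M claim_algebra" "subalgebra M counting_algebra" "subalgebra M discount_algebra"
  "subalgebra M weight_algebra" "subalgebra weight_algebra counting_algebra"
  "subalgebra weight_algebra discount_algebra"
  using indep_setD_ev1[OF indep_claim_weight] indep_setD_ev2[OF indep_claim_weight]
    indep_setD_ev1[OF indep_counting_discount] indep_setD_ev2[OF indep_counting_discount]
  by (auto simp: subalgebra_def space_algebras sets_weight_algebra)

text \<open>Independence is assumed for the counting process, not for the inter-arrival times. The
  identity between \<open>\<tau> \<le> t\<close> and \<open>N(t) \<ge> i\<close> recovers the
  arrival times from it; negative \<open>t\<close> are treated apart because the process starts at
  time 0.\<close>

lemma arrival_time_counting_measurable:
  assumes "1 \<le> i"
  shows "arrival_time \<theta> i \<in> borel_measurable counting_algebra"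
proof (rule borel_measurableI_le)
  fix t
  show "{\<omega>\<in>space counting_algebra. arrival_time \<theta> i \<omega> \<le> t} \<in> sets counting_algebra"
  proof (cases "0 \<le> t")
    case True
    have m: "counting \<theta> t \<in> measurable counting_algebra (count_space UNIV)"
      unfolding counting_algebra_def using True by (intro measurable_process_sigma) auto
    have "counting \<theta> t -` {enat i..} \<inter> space counting_algebra \<in> sets counting_algebra"
      by (rule measurable_sets[OF m]) simp
    moreover have "{\<omega>\<in>space counting_algebra. arrival_time \<theta> i \<omega> \<le> t} =
        counting \<theta> t -` {enat i..} \<inter> space counting_algebra"
      using le_counting_iff[OF _ assms] by (auto simp: space_algebras)
    ultimately show ?thesis by simp
  next
    case False
    then have "\<not> arrival_time \<theta> i \<omega> \<le> t" if "\<omega> \<in> space M" for \<omega>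
      using arrival_time_nonneg[OF that, of i] by linarith
    then have "{\<omega>\<in>space counting_algebra. arrival_time \<theta> i \<omega> \<le> t} = {}"
      by (auto simp: space_algebras)
    then show ?thesis by (simp only: sets.empty_sets)
  qed
qed

lemma xi_jointly_measurable:
  "(\<lambda>p. \<xi> (max 0 (fst p)) (snd p)) \<in> borel_measurable (borel \<Otimes>\<^sub>M discount_algebra)"
proof (rule right_continuous_jointly_measurable)
  show "\<xi> t \<in> borel_measurable discount_algebra" if "0 \<le> t" for t
    unfolding discount_algebra_def using that by (intro measurable_process_sigma) auto
  show "((\<lambda>s. \<xi> s \<omega>) \<longlongrightarrow> \<xi> t \<omega>) (at_right t)" if "\<omega> \<in> space discount_algebra" "0 \<le> t" for \<omega> t
    using xi_cadlag that by (simp add: cadlag_def space_algebras)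
qed

section \<open>Reduction to randomly weighted claims\<close>

definition Z :: "nat \<Rightarrow> 'a \<Rightarrow> real" where
  "Z i \<omega> = scalarize A (X (Suc i) \<omega>)"

definition E :: "nat \<Rightarrow> 'a set" where
  "E i = {\<omega>\<in>space M. arrival_time \<theta> (Suc i) \<omega> \<le> T}"

text \<open>Indices are shifted: weight, size and event \<open>i\<close> belong to claim
  \<open>i + 1\<close>. The value 0 after the horizon lets sums run over a fixed range.\<close>

definition c :: "nat \<Rightarrow> 'a \<Rightarrow> real" where
  "c i \<omega> = (if arrival_time \<theta> (Suc i) \<omega> \<le> T then exp (- \<xi> (arrival_time \<theta> (Suc i) \<omega>) \<omega>) else 0)"

lemma Z_claim_measurable: "Z i \<in> borel_measurable claim_algebra"
proof -
  have "X (Suc i) \<in> borel_measurable claim_algebra"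
    unfolding claim_algebra_def by (intro measurable_process_sigma) auto
  then show ?thesis
    unfolding Z_def[abs_def] by (rule measurable_compose[OF _ scalarize_measurable[OF A]])
qed

text \<open>The jointly measurable process is composed with the map from \<omega> to the pair of its
  arrival time and \<omega> itself.\<close>

lemma xi_arrival_measurable:
  "(\<lambda>\<omega>. \<xi> (arrival_time \<theta> (Suc i) \<omega>) \<omega>) \<in> borel_measurable weight_algebra"
proof -
  have "arrival_time \<theta> (Suc i) \<in> borel_measurable weight_algebra"
    by (rule measurable_from_subalg[OF subalgebras(5) arrival_time_counting_measurable]) simp
  moreover have "(\<lambda>\<omega>. \<omega>) \<in> measurable weight_algebra discount_algebra"
    by (rule measurable_from_subalg[OF subalgebras(6)]) simp
  ultimately have "(\<lambda>\<omega>. (arrival_time \<theta> (Suc i) \<omega>, \<omega>)) \<in> measurable weight_algebra (borel \<Otimes>\<^sub>M discount_algebra)"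
    by (rule measurable_Pair)
  from measurable_compose[OF this xi_jointly_measurable]
  have "(\<lambda>\<omega>. \<xi> (max 0 (arrival_time \<theta> (Suc i) \<omega>)) \<omega>) \<in> borel_measurable weight_algebra" by simp
  moreover have "\<xi> (max 0 (arrival_time \<theta> (Suc i) \<omega>)) \<omega> = \<xi> (arrival_time \<theta> (Suc i) \<omega>) \<omega>"
    if "\<omega> \<in> space weight_algebra" for \<omega>
    using arrival_time_nonneg[of \<omega> "Suc i"] that by (simp add: space_algebras max_absorb2)
  ultimately show ?thesis by (subst (asm) measurable_cong) auto
qed

lemma arrival_weight_measurable: "arrival_time \<theta> (Suc i) \<in> borel_measurable weight_algebra"
  by (rule measurable_from_subalg[OF subalgebras(5) arrival_time_counting_measurable]) simp

lemma c_weight_measurable: "c i \<in> borel_measurable weight_algebra"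
  unfolding c_def[abs_def]
  using xi_arrival_measurable[of i] arrival_weight_measurable[of i] by measurable

lemma E_weight: "E i \<in> sets weight_algebra"
proof -
  have "{\<omega>\<in>space weight_algebra. arrival_time \<theta> (Suc i) \<omega> \<le> T} \<in> sets weight_algebra"
    using arrival_weight_measurable[of i] by measurable
  then show ?thesis by (simp add: E_def space_algebras)
qed

definition G :: "real measure" where
  "G = distr F borel (scalarize A)"

lemma claim_size_measurable: "Z i \<in> borel_measurable M"
  by (rule measurable_from_subalg[OF subalgebras(1) Z_claim_measurable])

lemma claim_size_distr: "distr M borel (Z i) = G"
proof -
  have X: "X (Suc i) \<in> borel_measurable M" by (rule X_measurable) simp
  have "distr (distr M borel (X (Suc i))) borel (scalarize A) = distr M borel (Z i)"
    using scalarize_measurable[OF A] X by (subst distr_distr) (auto simp: Z_def[abs_def] comp_def)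
  then show ?thesis using X_distribution[of "Suc i"] by (simp add: G_def)
qed

sublocale randomly_weighted_claims M Z c E G "exp K"
proof
  show "Z i \<in> borel_measurable M" for i by (rule claim_size_measurable)
  show "0 \<le> Z i \<omega>" for i \<omega> by (simp add: Z_def scalarize_nonneg[OF A])
  show dZ: "distr M borel (Z i) = G" for i by (rule claim_size_distr)
  show "consistently_varying G"
    using F_consistent by (simp add: consistently_varying_on_def G_def)
  show "indep_var borel (c i) borel (Z i)" for i
    by (rule indep_var_of_indep_subalgebras[OF indep_weight_claim _ _ c_weight_measurable Z_claim_measurable])
      (simp_all add: space_algebras)
  show "0 \<le> c i \<omega>" for i \<omega> by (simp add: c_def)
  show "c i \<omega> = 0" if "\<omega> \<in> space M" "\<omega> \<notin> E i" for i \<omega> using that by (simp add: c_def E_def)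
  show "AE \<omega> in M. c i \<omega> \<le> exp K" for i
    using xi_bound AE_space
  proof eventually_elim
    case (elim \<omega>)
    show ?case
    proof (cases "arrival_time \<theta> (Suc i) \<omega> \<le> T")
      case True
      then have "arrival_time \<theta> (Suc i) \<omega> \<in> {0..T}" using arrival_time_nonneg elim by simp
      with elim(1) have "- K \<le> \<xi> (arrival_time \<theta> (Suc i) \<omega>) \<omega>" by blast
      then show ?thesis using True by (simp add: c_def)
    qed (simp add: c_def)
  qed
  show "1 \<le> exp K" using K_nonneg by simp
  show E: "E i \<in> events" for i
    using E_weight[of i] subalgebras(4) by (auto simp: subalgebra_def)
  show "0 < prob {\<omega>\<in>space M. 0 < c 0 \<omega>}"
  proof (rule ccontr)
    \<comment> \<open>Discount factors are positive, so only the arrival of the first claim matters.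
      Were it null, the counting process at \<open>T\<close> would vanish almost surely and so would
      the renewal function.\<close>
    have eq: "{\<omega>\<in>space M. 0 < c 0 \<omega>} = E 0" by (auto simp: c_def E_def)
    assume "\<not> ?thesis"
    then have "prob (E 0) = 0" unfolding eq using measure_nonneg[of M "E 0"] by linarith
    then have "AE \<omega> in M. \<omega> \<notin> E 0" using prob_eq_0[OF E] by simp
    then have "AE \<omega> in M. ennreal_of_enat (counting \<theta> T \<omega>) = 0"
      using AE_space
    proof eventually_elim
      case (elim \<omega>)
      then have "\<not> enat 1 \<le> counting \<theta> T \<omega>"
        using le_counting_iff[of \<omega> 1 T] by (simp add: E_def)
      then have "counting \<theta> T \<omega> = 0" by (cases "counting \<theta> T \<omega>") (auto simp: zero_enat_def)
      then show ?case by simp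
    qed
    then have "renewal_function M \<theta> T = (\<integral>\<^sup>+\<omega>. 0 \<partial>M)"
      unfolding renewal_function_def by (rule nn_integral_cong_AE)
    then show False using renewal_pos by simp
  qed
  show "E (Suc i) \<subseteq> E i" for i
    using arrival_time_mono[of _ "Suc i" "Suc (Suc i)"] by (fastforce simp: E_def)
  show "prob (E n \<inter> {\<omega>\<in>space M. x < Z i \<omega>}) = prob (E n) * tail G x" for n x i
  proof -
    have "{\<omega>\<in>space claim_algebra. x < Z i \<omega>} \<in> sets claim_algebra"
      using Z_claim_measurable[of i] by measurable
    from indep_setD[OF indep_claim_weight this E_weight[of n]]
    have "prob (E n \<inter> {\<omega>\<in>space M. x < Z i \<omega>}) = prob {\<omega>\<in>space M. x < Z i \<omega>} * prob (E n)"
      by (simp add: space_algebras Int_commute)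
    also have "prob {\<omega>\<in>space M. x < Z i \<omega>} = tail G x"
      using tail_distr[OF claim_size_measurable[of i], of x] by (simp add: claim_size_distr)
    finally show ?thesis by simp
  qed
  show "summable (\<lambda>n. real (Suc n) ^ p * prob (E n))" for p
    unfolding E_def by (rule arrival_time_moments)
  show "QAI M UNIV Z"
    using X_QAI unfolding QAI_on_def QAI_def Z_def[abs_def] by simp
qed

lemma scaled_claim_iff:
  assumes "0 < x" "0 < r"
  shows "r *\<^sub>R v \<in> scaled_set x A \<longleftrightarrow> x < r * scalarize A v"
  using assms by (simp add: scalarize_gt_iff[OF A, symmetric] scalarize_scaleR[OF A])

section \<open>Evaluation of the denominator\<close>

lemma claim_tail_integral:
  assumes "0 \<le> s" "0 < x"
  shows "ennreal \<P>(\<omega> in M. exp (- \<xi> s \<omega>) *\<^sub>R X 1 \<omega> \<in> scaled_set x A) =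
    (\<integral>\<^sup>+\<omega>. ennreal (tail G (x / exp (- \<xi> s \<omega>))) \<partial>M)"
proof -
  have "\<xi> s \<in> borel_measurable discount_algebra"
    unfolding discount_algebra_def using assms by (intro measurable_process_sigma) auto
  then have xi: "\<xi> s \<in> borel_measurable weight_algebra"
    by (rule measurable_from_subalg[OF subalgebras(6)])
  have exp: "(\<lambda>\<omega>. exp (- \<xi> s \<omega>)) \<in> borel_measurable weight_algebra"
    using xi by measurable
  have "indep_var borel (\<lambda>\<omega>. exp (- \<xi> s \<omega>)) borel (Z 0)"
    by (rule indep_var_of_indep_subalgebras[OF indep_weight_claim _ _ exp Z_claim_measurable])
      (simp_all add: space_algebras)
  from emeasure_product_gt[OF this assms(2) _ Z_nonneg]
  have "emeasure M {\<omega>\<in>space M. x < exp (- \<xi> s \<omega>) * Z 0 \<omega>} =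
      (\<integral>\<^sup>+\<omega>. ennreal (tail G (x / exp (- \<xi> s \<omega>))) \<partial>M)"
    by (simp add: Z_distr)
  then show ?thesis
    using assms by (simp add: scaled_claim_iff emeasure_eq_measure Z_def)
qed

text \<open>The renewal integral splits into one integral per arrival time. As arrivals and
  discounting are independent, integrating the deterministic-time tail over the law of an arrival
  time equals evaluating \<xi> at that random time, which is the formula for
  \<open>Y_tail\<close>.\<close>

lemma expected_claims_eq:
  assumes x: "0 < x"
  shows "(LINT s:{0..T}|renewal_measure M \<theta>.
      \<P>(\<omega> in M. exp (- \<xi> s \<omega>) *\<^sub>R X 1 \<omega> \<in> scaled_set x A)) = (\<Sum>i. Y_tail i x)"
proof -
  \<comment> \<open>\<open>P\<close> is \<open>M\<close> restricted to the discount sigma-algebra,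
    that is, the law of the identity viewed as a random element.\<close>
  define P where "P = distr M discount_algebra (\<lambda>\<omega>. \<omega>)"
  have id: "(\<lambda>\<omega>. \<omega>) \<in> measurable M discount_algebra"
    by (rule measurable_from_subalg[OF subalgebras(3)]) simp
  interpret P: prob_space P unfolding P_def by (rule prob_space_distr[OF id])
  have sets_P: "sets P = sets discount_algebra" by (simp add: P_def)
  define H where "H = (\<lambda>p. ennreal (tail G (x / exp (- \<xi> (max 0 (fst p)) (snd p)))))"
  have H: "H \<in> borel_measurable (borel \<Otimes>\<^sub>M discount_algebra)"
    unfolding H_def using xi_jointly_measurable by measurable
  then have H': "H \<in> borel_measurable (borel \<Otimes>\<^sub>M P)"
    by (simp cong: measurable_cong_sets add: sets_pair_measure_cong[OF refl sets_P])
  define h where "h = (\<lambda>s. indicator {0..T} s * (\<integral>\<^sup>+\<omega>. H (s, \<omega>) \<partial>P))"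
  have inner: "(\<lambda>s. \<integral>\<^sup>+\<omega>. H (s, \<omega>) \<partial>P) \<in> borel_measurable borel"
    using H' by (rule P.borel_measurable_nn_integral_fst)
  have h[measurable]: "h \<in> borel_measurable borel"
    unfolding h_def using inner by measurable
  define f where "f = (\<lambda>s. indicat_real {0..T} s *
      \<P>(\<omega> in M. exp (- \<xi> s \<omega>) *\<^sub>R X 1 \<omega> \<in> scaled_set x A))"
  have fh: "ennreal (f s) = h s" for s
  proof (cases "s \<in> {0..T}")
    case True
    then have "ennreal (f s) = (\<integral>\<^sup>+\<omega>. H (s, \<omega>) \<partial>M)"
      using x by (simp add: f_def claim_tail_integral[unfolded One_nat_def] H_def max_absorb2)
    also have "\<dots> = (\<integral>\<^sup>+\<omega>. H (s, \<omega>) \<partial>P)"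
      unfolding P_def using H by (subst nn_integral_distr[OF id]) auto
    finally show ?thesis using True by (simp add: h_def)
  qed (simp add: f_def h_def)
  have f_nonneg: "0 \<le> f s" for s by (simp add: f_def)
  \<comment> \<open>Measurability of the real integrand is inherited from the partial integral
    \<open>h\<close> of a jointly measurable function.\<close>
  have f: "f \<in> borel_measurable borel"
  proof -
    have "f = (\<lambda>s. enn2real (h s))" using f_nonneg by (simp add: fh[symmetric])
    then show ?thesis by simp
  qed
  have sets_R: "sets (renewal_measure M \<theta>) = sets borel"
    using sets.sigma_sets_eq[of "borel :: real measure"]
    by (simp add: renewal_measure_def sets_measure_of)
  have "(LINT s:{0..T}|renewal_measure M \<theta>.
      \<P>(\<omega> in M. exp (- \<xi> s \<omega>) *\<^sub>R X 1 \<omega> \<in> scaled_set x A)) = (\<integral>s. f s \<partial>renewal_measure M \<theta>)"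
    by (simp add: set_lebesgue_integral_def f_def)
  also have "\<dots> = enn2real (\<integral>\<^sup>+s. h s \<partial>renewal_measure M \<theta>)"
    using f f_nonneg sets_R
    by (subst integral_eq_nn_integral) (auto simp: fh cong: measurable_cong_sets)
  also have "(\<integral>\<^sup>+s. h s \<partial>renewal_measure M \<theta>) =
      (\<Sum>i. \<integral>\<^sup>+\<omega>. h (arrival_time \<theta> (Suc i) \<omega>) \<partial>M)"
    by (rule nn_integral_renewal_measure[OF h])
  also have "\<dots> = (\<Sum>i. ennreal (Y_tail i x))"
  proof (rule suminf_cong)
    fix i
    let ?\<tau> = "arrival_time \<theta> (Suc i)"
    have \<tau>: "?\<tau> \<in> borel_measurable counting_algebra"
      by (rule arrival_time_counting_measurable) simp
    have \<tau>'[measurable]: "?\<tau> \<in> borel_measurable M" by (rule arrival_time_measurable)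
    \<comment> \<open>The arrival time is independent of the identity into
      \<open>discount_algebra\<close>, so the pair has a product law although both are functions of
      the same \<omega>.\<close>
    have prod: "distr M borel ?\<tau> \<Otimes>\<^sub>M P = distr M (borel \<Otimes>\<^sub>M discount_algebra) (\<lambda>\<omega>. (?\<tau> \<omega>, \<omega>))"
      unfolding P_def
      by (rule distr_pair_of_indep_subalgebras[OF indep_counting_discount _ _ \<tau>])
        (simp_all add: space_algebras)
    have pair: "(\<lambda>\<omega>. (?\<tau> \<omega>, \<omega>)) \<in> measurable M (borel \<Otimes>\<^sub>M discount_algebra)"
      by (rule measurable_Pair[OF \<tau>' id])
    define H2 where "H2 = (\<lambda>p. indicator {0..T} (fst p) * H p :: ennreal)"
    have H2: "H2 \<in> borel_measurable (borel \<Otimes>\<^sub>M discount_algebra)"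
      unfolding H2_def using H by measurable
    then have H2': "H2 \<in> borel_measurable (borel \<Otimes>\<^sub>M P)"
      by (simp cong: measurable_cong_sets add: sets_pair_measure_cong[OF refl sets_P])
    have "(\<integral>\<^sup>+\<omega>. h (?\<tau> \<omega>) \<partial>M) = (\<integral>\<^sup>+s. h s \<partial>distr M borel ?\<tau>)"
      by (subst nn_integral_distr) simp_all
    also have "\<dots> = (\<integral>\<^sup>+s. \<integral>\<^sup>+\<omega>. H2 (s, \<omega>) \<partial>P \<partial>distr M borel ?\<tau>)"
    proof (rule nn_integral_cong)
      fix s
      have "(\<lambda>\<omega>. H (s, \<omega>)) \<in> borel_measurable P"
        by (rule measurable_compose[OF measurable_Pair1' H']) simp
      then show "h s = (\<integral>\<^sup>+\<omega>. H2 (s, \<omega>) \<partial>P)"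
        by (simp add: h_def H2_def nn_integral_cmult)
    qed
    also have "\<dots> = (\<integral>\<^sup>+p. H2 p \<partial>(distr M borel ?\<tau> \<Otimes>\<^sub>M P))"
      using H2' by (intro P.nn_integral_fst) simp
    also have "\<dots> = (\<integral>\<^sup>+\<omega>. H2 (?\<tau> \<omega>, \<omega>) \<partial>M)"
      unfolding prod by (rule nn_integral_distr[OF pair]) (simp add: H2)
    also have "\<dots> = (\<integral>\<^sup>+\<omega>. ennreal (if 0 < c i \<omega> then tail G (x / c i \<omega>) else 0) \<partial>M)"
    proof (rule nn_integral_cong)
      fix \<omega> assume "\<omega> \<in> space M"
      then have "0 \<le> ?\<tau> \<omega>" by (rule arrival_time_nonneg)
      then show "H2 (?\<tau> \<omega>, \<omega>) = ennreal (if 0 < c i \<omega> then tail G (x / c i \<omega>) else 0)"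
        by (simp add: H2_def H_def c_def max_absorb2)
    qed
    also have "\<dots> = ennreal (Y_tail i x)" using x by (rule Y_tail_eq[symmetric])
    finally show "(\<integral>\<^sup>+\<omega>. h (?\<tau> \<omega>) \<partial>M) = ennreal (Y_tail i x)" .
  qed
  also have "\<dots> = ennreal (\<Sum>i. Y_tail i x)"
    \<comment> \<open>Summability makes the total finite, so \<open>enn2real\<close> returns the
      actual sum and not its default 0 at infinity.\<close>
    by (rule suminf_ennreal2[OF _ summable_Y_tail[OF x]]) (simp add: Y_tail_def)
  finally show ?thesis
    using suminf_nonneg[OF summable_Y_tail[OF x]] by (simp add: Y_tail_def)
qed

section \<open>The aggregate claim vector and conclusion\<close>

lemma discounted_claims_eq_sum:
  assumes "\<omega> \<in> space M" "\<omega> \<notin> E n"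
  shows "discounted_claims X \<theta> \<xi> T \<omega> = (\<Sum>i<n. c i \<omega> *\<^sub>R X (Suc i) \<omega>)"
proof -
  let ?I = "{i. 1 \<le> i \<and> enat i \<le> counting \<theta> T \<omega>}"
  have I: "?I = Suc ` {i. \<omega> \<in> E i}"
  proof (intro set_eqI iffI)
    fix i assume i: "i \<in> ?I"
    then obtain j where "i = Suc j" by (cases i) auto
    with i show "i \<in> Suc ` {i. \<omega> \<in> E i}"
      using le_counting_iff[OF assms(1), of i T] assms(1) by (auto simp: E_def)
  next
    fix i assume "i \<in> Suc ` {i. \<omega> \<in> E i}"
    then show "i \<in> ?I" using le_counting_iff[OF assms(1), of i T] by (auto simp: E_def)
  qed
  have sub: "{i. \<omega> \<in> E i} \<subseteq> {..<n}"
  proof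
    fix i assume "i \<in> {i. \<omega> \<in> E i}"
    then show "i \<in> {..<n}" using assms(2) E_mono[of n i] by (cases "n \<le> i") auto
  qed
  have "discounted_claims X \<theta> \<xi> T \<omega> = (\<Sum>i\<in>{i. \<omega> \<in> E i}. c i \<omega> *\<^sub>R X (Suc i) \<omega>)"
    unfolding discounted_claims_def I by (subst sum.reindex) (auto simp: c_def E_def intro!: sum.cong)
  \<comment> \<open>Indices below \<open>n\<close> whose claim has not arrived are harmless, as
    their weight is 0; hence any \<open>n\<close> with \<open>\<omega> \<notin> E n\<close> will
    do.\<close>
  also have "\<dots> = (\<Sum>i<n. c i \<omega> *\<^sub>R X (Suc i) \<omega>)"
    using sub assms(1) by (intro sum.mono_neutral_left) (auto simp: c_zero)
  finally show ?thesis .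
qed

text \<open>A sum over an infinite index set is 0 by default. This fixes the value on the null event
  of infinitely many arrivals, and 0 lies outside \<open>scaled_set x A\<close> for positive
  \<open>x\<close>.\<close>

lemma discounted_claims_infinite:
  assumes "\<omega> \<in> space M" "\<And>n. \<omega> \<in> E n"
  shows "discounted_claims X \<theta> \<xi> T \<omega> = 0"
proof -
  let ?I = "{i. 1 \<le> i \<and> enat i \<le> counting \<theta> T \<omega>}"
  have "Suc i \<in> ?I" for i
    using assms(2)[of i] le_counting_iff[OF assms(1), of "Suc i" T] by (simp add: E_def)
  then have "range Suc \<subseteq> ?I" by auto
  then have "infinite ?I" using range_inj_infinite[of Suc] finite_subset by auto
  then show ?thesis unfolding discounted_claims_def by (rule sum.infinite)
qed

lemma discounted_claims_measurable: "discounted_claims X \<theta> \<xi> T \<in> borel_measurable M"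
proof -
  have [measurable]: "X (Suc i) \<in> borel_measurable M" for i by (rule X_measurable) simp
  \<comment> \<open>The random number of summands is measurable with countably many values, so it
    suffices to treat each fixed number.\<close>
  let ?N = "\<lambda>\<omega>. LEAST n. \<omega> \<notin> E n"
  have [measurable]: "?N \<in> measurable M (count_space UNIV)" by measurable
  have sum[measurable]: "(\<lambda>\<omega>. \<Sum>i<?N \<omega>. c i \<omega> *\<^sub>R X (Suc i) \<omega>) \<in> borel_measurable M"
    by (rule measurable_compose_countable[of "\<lambda>n \<omega>. \<Sum>i<n. c i \<omega> *\<^sub>R X (Suc i) \<omega>"]) measurable
  have "(\<lambda>\<omega>. if \<forall>n. \<omega> \<in> E n then 0 else \<Sum>i<?N \<omega>. c i \<omega> *\<^sub>R X (Suc i) \<omega>) \<in> borel_measurable M"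
    by measurable
  moreover have "discounted_claims X \<theta> \<xi> T \<omega> =
      (if \<forall>n. \<omega> \<in> E n then 0 else \<Sum>i<?N \<omega>. c i \<omega> *\<^sub>R X (Suc i) \<omega>)" if "\<omega> \<in> space M" for \<omega>
  proof (cases "\<forall>n. \<omega> \<in> E n")
    case True
    then show ?thesis using discounted_claims_infinite[OF that] by simp
  next
    case False
    then have "\<exists>n. \<omega> \<notin> E n" by simp
    then have "\<omega> \<notin> E (?N \<omega>)" by (rule LeastI_ex)
    then show ?thesis unfolding if_not_P[OF False] by (rule discounted_claims_eq_sum[OF that])
  qed
  ultimately show ?thesis by (subst measurable_cong) auto
qed

lemma AE_finitely_many_claims: "AE \<omega> in M. \<exists>n. \<omega> \<notin> E n"
proof -
  have "AE \<omega> in M. \<not> (\<forall>n. \<omega> \<in> E n)"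
  proof -
    have "prob (\<Inter>n. E n) \<le> prob (E n)" for n by (intro finite_measure_mono) auto
    moreover have "(\<lambda>n. prob (E n)) \<longlonglongrightarrow> 0" by (rule summable_LIMSEQ_zero[OF summable_E])
    ultimately have "prob (\<Inter>n. E n) \<le> 0" by (intro LIMSEQ_le_const) auto
    then have "prob (\<Inter>n. E n) = 0" using measure_nonneg[of M "\<Inter>n. E n"] by linarith
    moreover have "(\<Inter>n. E n) \<in> events" by auto
    ultimately have "AE \<omega> in M. \<omega> \<notin> (\<Inter>n. E n)" using prob_eq_0 by blast
    then show ?thesis by simp
  qed
  then show ?thesis by simp
qed

lemma AE_claims_nonneg: "AE \<omega> in M. \<forall>i k. 0 \<le> X (Suc i) \<omega> $ k"
  unfolding AE_all_countable[of "\<lambda>i \<omega>. \<forall>k. 0 \<le> X (Suc i) \<omega> $ k"]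
proof
  fix i
  have X: "X (Suc i) \<in> borel_measurable M" by (rule X_measurable) simp
  have F: "distr M borel (X (Suc i)) = F" by (rule X_distribution) simp
  have "AE x in distr M borel (X (Suc i)). \<forall>k. 0 \<le> x $ k"
    unfolding F by (rule F_nonneg)
  then show "AE \<omega> in M. \<forall>k. 0 \<le> X (Suc i) \<omega> $ k"
    by (rule AE_distrD[OF X])
qed

lemma ruin_tail_asymptotics:
  "((\<lambda>x. \<P>(\<omega> in M. discounted_claims X \<theta> \<xi> T \<omega> \<in> scaled_set x A) /
      (LINT s:{0..T}|renewal_measure M \<theta>.
        \<P>(\<omega> in M. exp (- \<xi> s \<omega>) *\<^sub>R X 1 \<omega> \<in> scaled_set x A))) \<longlongrightarrow> 1) at_top"
proof -
  define D where "D x = {\<omega>\<in>space M. discounted_claims X \<theta> \<xi> T \<omega> \<in> scaled_set x A}" for x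
  \<comment> \<open>By homogeneity a weighted size is the scalarization of the discounted claim;
    weight 0 is covered by the value at the zero vector.\<close>
  have Y: "Y i \<omega> = scalarize A (c i \<omega> *\<^sub>R X (Suc i) \<omega>)" if "\<omega> \<in> space M" for i \<omega>
    using c_nonneg[OF that, of i] scalarize_zero[OF A]
    by (cases "c i \<omega> = 0") (simp_all add: Y_def Z_def scalarize_scaleR[OF A])
  have "((\<lambda>x. prob (D x) / (\<Sum>i. Y_tail i x)) \<longlongrightarrow> 1) at_top"
  proof (rule one_big_jump)
    fix x :: real assume x: "0 < x"
    have "scaled_set x A \<in> sets borel"
      using A x by (intro borel_open open_scaled_set) (auto simp: family_R_def)
    then show "D x \<in> events"
      using measurable_sets[OF discounted_claims_measurable, of "scaled_set x A"]
      by (simp add: D_def vimage_def Int_def conj_commute)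
    \<comment> \<open>One discounted claim in \<open>scaled_set x A\<close> suffices, since adding
      the others can only increase the scalarization. Their nonnegativity, and finiteness of their
      number, hold almost surely.\<close>
    show "AE \<omega> in M. x < Y i \<omega> \<longrightarrow> \<omega> \<in> D x" for i
      using AE_finitely_many_claims AE_claims_nonneg AE_space
    proof (eventually_elim, intro impI)
      fix \<omega> assume fin: "\<exists>n. \<omega> \<notin> E n" and nn: "\<forall>i k. 0 \<le> X (Suc i) \<omega> $ k"
        and \<omega>: "\<omega> \<in> space M" and gt: "x < Y i \<omega>"
      obtain n where n: "\<omega> \<notin> E n" using fin ..
      have "\<omega> \<in> E i" using gt x c_zero[OF \<omega>, of i] by (cases "\<omega> \<in> E i") (simp_all add: Y_def)
      then have "i < n" using n E_mono[of n i] by (cases "n \<le> i") auto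
      let ?v = "\<lambda>i. c i \<omega> *\<^sub>R X (Suc i) \<omega>"
      have "scalarize A (?v i) \<le> scalarize A (?v i + (\<Sum>j\<in>{..<n} - {i}. ?v j))"
        using nn c_nonneg[OF \<omega>] by (intro scalarize_mono[OF A]) (simp add: sum_nonneg)
      also have "?v i + (\<Sum>j\<in>{..<n} - {i}. ?v j) = discounted_claims X \<theta> \<xi> T \<omega>"
        using \<open>i < n\<close> unfolding discounted_claims_eq_sum[OF \<omega> n]
        by (subst sum.remove[of "{..<n}" i]) simp_all
      finally have "x < scalarize A (discounted_claims X \<theta> \<xi> T \<omega>)"
        using gt Y[OF \<omega>, of i] by simp
      then show "\<omega> \<in> D x" using \<omega> x by (simp add: D_def scalarize_gt_iff[OF A])
    qed
    fix \<omega> assume "\<omega> \<in> D x"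
    then have \<omega>: "\<omega> \<in> space M" and gt: "x < scalarize A (discounted_claims X \<theta> \<xi> T \<omega>)"
      using x by (auto simp: D_def scalarize_gt_iff[OF A])
    \<comment> \<open>A nonzero total rules out infinitely many arrivals, so the upper inclusion
      holds for every \<omega> in \<open>D x\<close>.\<close>
    have "discounted_claims X \<theta> \<xi> T \<omega> \<noteq> 0"
      using gt x scalarize_zero[OF A] by auto
    then obtain n where n: "\<omega> \<notin> E n" using discounted_claims_infinite[OF \<omega>] by blast
    have "scalarize A (discounted_claims X \<theta> \<xi> T \<omega>) \<le> (\<Sum>i<n. Y i \<omega>)"
      unfolding discounted_claims_eq_sum[OF \<omega> n] Y[OF \<omega>] by (rule scalarize_sum[OF A])
    with gt n show "\<exists>n. \<omega> \<notin> E n \<and> x < (\<Sum>i<n. Y i \<omega>)" by (intro exI[of _ n]) simp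
  qed
  moreover have "eventually (\<lambda>x. prob (D x) / (\<Sum>i. Y_tail i x) =
      \<P>(\<omega> in M. discounted_claims X \<theta> \<xi> T \<omega> \<in> scaled_set x A) /
      (LINT s:{0..T}|renewal_measure M \<theta>.
        \<P>(\<omega> in M. exp (- \<xi> s \<omega>) *\<^sub>R X 1 \<omega> \<in> scaled_set x A))) at_top"
    using eventually_gt_at_top[of 0]
    by eventually_elim (simp only: D_def expected_claims_eq)
  ultimately show ?thesis by (rule Lim_transform_eventually)
qed

end

theorem theorem3p2:
  fixes M :: "'a measure"
    and X :: "nat \<Rightarrow> 'a \<Rightarrow> real ^ 'n"
    and F :: "(real ^ 'n) measure"
    and \<theta> :: "nat \<Rightarrow> 'a \<Rightarrow> real"
    and \<xi> :: "real \<Rightarrow> 'a \<Rightarrow> real"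
    and A :: "(real ^ 'n) set"
    and T :: real
  assumes "renewal_risk_model M X F \<theta> \<xi>"
    and "A \<in> family_R"
    and "prob_space.indep_sets M
           (\<lambda>k::nat. [process_sigma M borel {1..} X,
                      process_sigma M (count_space UNIV) {0..} (counting \<theta>),
                      process_sigma M borel {0..} \<xi>] ! k) {0, 1, 2}"
    and "\<forall>t\<in>finite_horizons M \<theta>. \<exists>K>0.
           \<P>(\<omega> in M. (INF s\<in>{0..t}. ereal (\<xi> s \<omega>)) \<ge> ereal (- K)) = 1"
    and "QAI_on A M {1..} X"
    and "consistently_varying_on A F"
    and "T \<in> finite_horizons M \<theta>"
  shows "((\<lambda>x. \<P>(\<omega> in M. discounted_claims X \<theta> \<xi> T \<omega> \<in> scaled_set x A) /
               (LINT s:{0..T}|renewal_measure M \<theta>.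
                  \<P>(\<omega> in M. exp (- \<xi> s \<omega>) *\<^sub>R X 1 \<omega> \<in> scaled_set x A)))
          \<longlongrightarrow> 1) at_top"
proof -
  interpret renewal_risk_model M X F \<theta> \<xi> by (rule assms(1))
  obtain K where K: "K > 0"
    and bound: "\<P>(\<omega> in M. (INF s\<in>{0..T}. ereal (\<xi> s \<omega>)) \<ge> ereal (- K)) = 1"
    using assms(4,7) by blast
  \<comment> \<open>Measurability of the uncountable infimum event comes with its probability being
    1, as \<open>measure\<close> is 0 outside the sigma-algebra.\<close>
  have "AE \<omega> in M. (INF s\<in>{0..T}. ereal (\<xi> s \<omega>)) \<ge> ereal (- K)"
    using AE_prob_1[OF bound] by simp
  then have "AE \<omega> in M. \<forall>s\<in>{0..T}. - K \<le> \<xi> s \<omega>"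
    by eventually_elim (simp add: le_INF_iff)
  then interpret heavy_tailed_renewal_model M X F \<theta> \<xi> A T K
    using assms K by unfold_locales (auto simp: finite_horizons_def)
  show ?thesis by (rule ruin_tail_asymptotics)
qed

end
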